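(* Let $(G_1,u_1,v_1)$ and $(G_2,u_2,v_2)$ be twice-marked graphs of genera $g_1,g_2$ on which all divisors are submodular, and let $(G,u,v)=(G,u_1,v_2)$ be their vertex gluing. Suppose the once-marked graph $(G_1,v_1)$ is Brill–Noether general and $(G_2,u_2,v_2)$ has $k$-general transmission with $k>g_1+g_2$. Then the once-marked graph $(G,v)$ is Brill–Noether general.
   Context: A graph is a finite, connected, loopless multigraph (parallel edges allowed); its genus is $g=|E(G)|-|V(G)|+1$. A divisor is an element of the free abelian group on $V(G)$. Linear equivalence $\sim$ is generated by chip-firing (firing $w$ subtracts $\mathrm{val}(w)$ chips from $w$ and adds to each other vertex the number of edges joining it to $w$). The rank $r(D)$ is $-1$ if $D$ is not equivalent to an effective divisor, else the largest $r\ge0$ such that $D-E$ is equivalent to an effective divisor for every effective $E$ of degree $r$. $\delta(P)$ is $1$ if $P$ holds and $0$ otherwise. A twice-marked graph $(G,u,v)$ is a graph with two chosen vertices. A twist of $D$ is $D+au+bv$. $\Delta(D)=r(D)-r(D-u)-r(D-v)+r(D-u-v)$. $D$ is submodular if $\Delta(D')\ge0$ for all twists $D'$. If $D$ is submodular, its transmission permutation $\tau^{u,v}_D$ is the unique bijection $\mathbb Z\to\mathbb Z$ with $\delta(\tau^{u,v}_D(b)=a)=\Delta(D+au-bv)$ for all $a,b$. An inversion of a bijection $\tau$ is a pair $(a,b)$ with $a<b$, $\tau(a)>\tau(b)$; two inversions $(a,b),(a',b')$ are $k$-equivalent if $a-a'=b-b'\equiv0\pmod k$; $\mathrm{inv}_k(\tau)$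 is the number of classes. A genus-$g$ twice-marked graph has $k$-general transmission if $ku\sim kv$, every divisor is submodular, and $\mathrm{inv}_k(\tau^{u,v}_D)\le g$ for every divisor $D$. Vertex gluing of $(G_1,u_1,v_1)$ and $(G_2,u_2,v_2)$ is $(G,u_1,v_2)$ where $G$ is the disjoint union with $v_1$ identified with $u_2$. For a vertex $v$ and divisor $D$ on a genus-$g$ graph, $s_i(D,v)=\min\{\ell\in\mathbb Z: r(D+\ell v)\ge i\}$ and $\lambda_i(D,v)=i-s_i(D,v)+g-\deg D$ for $i\ge0$; the Weierstrass partition $\lambda(D,v)=(\lambda_0,\lambda_1,\dots)$ is a nonincreasing sequence of nonnegative integers, finitely many nonzero, and $|\lambda(D,v)|=\sum_i\lambda_i(D,v)$. A once-marked graph $(G,v)$ of genus $g$ is Brill–Noether general if $|\lambda(D,v)|\le g$ for every divisor $D$. *)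

theory Defs
  imports Main "HOL-Library.Extended_Nat"
begin

record 'v mgraph =
  verts :: "'v set"
  mult  :: "'v \<Rightarrow> 'v \<Rightarrow> nat"

definition is_graph :: "'v mgraph \<Rightarrow> bool" where
  "is_graph G \<longleftrightarrow>
     finite (verts G) \<and> verts G \<noteq> {} \<and>
     (\<forall>x y. mult G x y = mult G y x) \<and>
     (\<forall>x. mult G x x = 0) \<and>
     (\<forall>x y. mult G x y > 0 \<longrightarrow> x \<in> verts G \<and> y \<in> verts G) \<and>
     (\<forall>x\<in>verts G. \<forall>y\<in>verts G. (\<lambda>a b. mult G a b > 0)\<^sup>*\<^sup>* x y)"

definition num_edges :: "'v mgraph \<Rightarrow> nat" where
  "num_edges G = (\<Sum>x\<in>verts G. \<Sum>y\<in>verts G. mult G x y) div 2"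

definition genus :: "'v mgraph \<Rightarrow> int" where
  "genus G = int (num_edges G) - int (card (verts G)) + 1"

definition valence :: "'v mgraph \<Rightarrow> 'v \<Rightarrow> nat" where
  "valence G x = (\<Sum>y\<in>verts G. mult G x y)"

type_synonym 'v divisor = "'v \<Rightarrow> int"

definition is_divisor :: "'v mgraph \<Rightarrow> 'v divisor \<Rightarrow> bool" where
  "is_divisor G D \<longleftrightarrow> (\<forall>x. x \<notin> verts G \<longrightarrow> D x = 0)"

definition pt :: "'v \<Rightarrow> 'v divisor" where
  "pt v = (\<lambda>x. if x = v then 1 else 0)"

definition deg :: "'v mgraph \<Rightarrow> 'v divisor \<Rightarrow> int" where
  "deg G D = (\<Sum>x\<in>verts G. D x)"

definition effective :: "'v mgraph \<Rightarrow> 'v divisor \<Rightarrow> bool" where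
  "effective G D \<longleftrightarrow> (\<forall>x\<in>verts G. D x \<ge> 0)"

text \<open>Linear equivalence = equivalence relation generated by chip-firing.  Since
  firings commute, \<open>D \<sim> D'\<close> iff \<open>D'\<close> arises from \<open>D\<close> by firing every vertex
  \<open>y\<close> exactly \<open>f y\<close> times (negative meaning reverse firing).\<close>

definition lin_equiv :: "'v mgraph \<Rightarrow> 'v divisor \<Rightarrow> 'v divisor \<Rightarrow> bool" where
  "lin_equiv G D D' \<longleftrightarrow>
     (\<exists>f :: 'v \<Rightarrow> int. \<forall>x\<in>verts G.
        D' x = D x - f x * int (valence G x) + (\<Sum>y\<in>verts G. int (mult G x y) * f y))"

definition winnable :: "'v mgraph \<Rightarrow> 'v divisor \<Rightarrow> bool" where
  "winnable G D \<longleftrightarrow> (\<exists>E. is_divisor G E \<and> effective G E \<and> lin_equiv G D E)"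

definition rank :: "'v mgraph \<Rightarrow> 'v divisor \<Rightarrow> int" where
  "rank G D =
     (if \<not> winnable G D then -1
      else int (GREATEST r :: nat. \<forall>E. is_divisor G E \<and> effective G E \<and> deg G E = int r
                 \<longrightarrow> winnable G (\<lambda>x. D x - E x)))"

definition Delta :: "'v mgraph \<Rightarrow> 'v \<Rightarrow> 'v \<Rightarrow> 'v divisor \<Rightarrow> int" where
  "Delta G u v D = rank G D - rank G (\<lambda>x. D x - pt u x) - rank G (\<lambda>x. D x - pt v x)
                   + rank G (\<lambda>x. D x - pt u x - pt v x)"

definition twist :: "'v \<Rightarrow> 'v \<Rightarrow> 'v divisor \<Rightarrow> int \<Rightarrow> int \<Rightarrow> 'v divisor" where
  "twist u v D a b = (\<lambda>x. D x + a * pt u x + b * pt v x)"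

definition submodular :: "'v mgraph \<Rightarrow> 'v \<Rightarrow> 'v \<Rightarrow> 'v divisor \<Rightarrow> bool" where
  "submodular G u v D \<longleftrightarrow> (\<forall>a b. Delta G u v (twist u v D a b) \<ge> 0)"

definition all_submodular :: "'v mgraph \<Rightarrow> 'v \<Rightarrow> 'v \<Rightarrow> bool" where
  "all_submodular G u v \<longleftrightarrow> (\<forall>D. is_divisor G D \<longrightarrow> submodular G u v D)"

definition transmission :: "'v mgraph \<Rightarrow> 'v \<Rightarrow> 'v \<Rightarrow> 'v divisor \<Rightarrow> (int \<Rightarrow> int)" where
  "transmission G u v D =
     (THE \<tau>. bij \<tau> \<and> (\<forall>a b. (if \<tau> b = a then 1 else 0) = Delta G u v (twist u v D a (- b))))"

definition inversions :: "(int \<Rightarrow> int) \<Rightarrow> (int \<times> int) set" where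
  "inversions \<tau> = {(a, b). a < b \<and> \<tau> a > \<tau> b}"

definition k_equiv :: "int \<Rightarrow> ((int \<times> int) \<times> (int \<times> int)) set" where
  "k_equiv k = {((a, b), (a', b')). a - a' = b - b' \<and> k dvd (a - a')}"

definition inv_k :: "int \<Rightarrow> (int \<Rightarrow> int) \<Rightarrow> enat" where
  "inv_k k \<tau> =
     (let Q = inversions \<tau> // (k_equiv k \<inter> (inversions \<tau> \<times> inversions \<tau>))
      in if finite Q then enat (card Q) else \<infinity>)"

definition k_general_transmission :: "nat \<Rightarrow> 'v mgraph \<Rightarrow> 'v \<Rightarrow> 'v \<Rightarrow> bool" where
  "k_general_transmission k G u v \<longleftrightarrow>
     lin_equiv G (\<lambda>x. int k * pt u x) (\<lambda>x. int k * pt v x) \<and>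
     all_submodular G u v \<and>
     (\<forall>D. is_divisor G D \<longrightarrow>
        inv_k (int k) (transmission G u v D) \<le> enat (nat (genus G)))"

text \<open>Vertices of the glued graph live in \<open>'a + 'b\<close>; the vertex \<open>u\<^sub>2\<close> of \<open>G\<^sub>2\<close>
  is identified with \<open>Inl v\<^sub>1\<close> (so \<open>Inr u\<^sub>2\<close> is not a vertex).\<close>

definition glue_map :: "'a \<Rightarrow> 'b \<Rightarrow> 'b \<Rightarrow> 'a + 'b" where
  "glue_map v1 u2 y = (if y = u2 then Inl v1 else Inr y)"

definition vertex_glue :: "'a mgraph \<Rightarrow> 'a \<Rightarrow> 'b mgraph \<Rightarrow> 'b \<Rightarrow> ('a + 'b) mgraph" where
  "vertex_glue G1 v1 G2 u2 =
     \<lparr> verts = Inl ` verts G1 \<union> Inr ` (verts G2 - {u2}),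
       mult = (\<lambda>p q.
         (case (p, q) of (Inl a, Inl a') \<Rightarrow> mult G1 a a' | _ \<Rightarrow> 0)
         + (\<Sum>y\<in>{y\<in>verts G2. glue_map v1 u2 y = p}.
              \<Sum>y'\<in>{y'\<in>verts G2. glue_map v1 u2 y' = q}. mult G2 y y')) \<rparr>"

definition s_idx :: "'v mgraph \<Rightarrow> 'v divisor \<Rightarrow> 'v \<Rightarrow> nat \<Rightarrow> int" where
  "s_idx G D v i = (LEAST l :: int. rank G (\<lambda>x. D x + l * pt v x) \<ge> int i)"

definition lambda_idx :: "'v mgraph \<Rightarrow> 'v divisor \<Rightarrow> 'v \<Rightarrow> nat \<Rightarrow> int" where
  "lambda_idx G D v i = int i - s_idx G D v i + genus G - deg G D"

definition weierstrass_size :: "'v mgraph \<Rightarrow> 'v divisor \<Rightarrow> 'v \<Rightarrow> int" where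
  "weierstrass_size G D v = (\<Sum>i\<in>{i. lambda_idx G D v i \<noteq> 0}. lambda_idx G D v i)"

definition BN_general :: "'v mgraph \<Rightarrow> 'v \<Rightarrow> bool" where
  "BN_general G v \<longleftrightarrow>
     (\<forall>D. is_divisor G D \<longrightarrow>
        finite {i. lambda_idx G D v i \<noteq> 0} \<and> weierstrass_size G D v \<le> genus G)"

end

theory Submission
  imports Defs
begin

text \<open>
  Write \<open>\<rho> D = rank D + 1\<close>. A divisor on the glued graph is winnable iff chips can be moved across the
  gluing vertex so that both sides become winnable, which gives
  \<open>\<rho> D = min\<^sub>m (\<rho> (D\<^sub>1 + (m - 1) v\<^sub>1) + \<rho> (D\<^sub>2 - m u\<^sub>2))\<close>. As a function of a twist at \<open>v\<^sub>2\<close>, the second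
  term counts \<open>{j \<ge> b. \<tau> j \<le> a}\<close> for the transmission permutation \<open>\<tau>\<close>, so the Weierstrass partition of
  the glued graph is the Demazure product of the partition of \<open>D\<^sub>1\<close> with \<open>\<tau>\<close>. Because \<open>k u\<^sub>2 \<sim> k v\<^sub>2\<close>, \<open>\<tau>\<close> is
  \<open>k\<close>-periodic, hence a shift followed by \<open>inv\<^sub>k \<tau>\<close> affine simple transpositions. Each of these adds boxes
  whose contents agree mod \<open>k\<close>; two such boxes can be added at once only to a partition of size at
  least \<open>k - 1\<close>, so for \<open>k > g\<^sub>1 + g\<^sub>2\<close> every transposition adds at most one box.
\<close>

subsection \<open>Chip firing and rank\<close>

text \<open>The partition of a divisor \<open>D\<close> is handled through the function sending
  \<open>m\<close> to \<open>rank (D + m v) + 1\<close>, because gluing acts pointwise on these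
  functions but not on the parts of the partition. Both ends of such a function must be known: it is
  0 in negative degree and degree - g + 1 in large degree. The second end rests on two facts: every
  divisor of degree g is winnable (reduced divisors and burning), and some divisor of degree g - 1
  is not (an acyclic orientation). The bound on \<open>k\<close> is a budget. Transpositions are
  peeled off \<open>\<tau>\<close> at descents, one per inversion class, so n of them with n at most
  g2. Before the last one acts there are at most g1 + n - 1 boxes, fewer than k - 1. Two addable
  corners of equal residue lie on diagonals at least k apart, and every diagonal strictly between
  them already carries a box, so together they would need k - 1 boxes. Without this bound one
  transposition could fill several corners at once, and counting inversion classes would not control
  the number of boxes.\<close>

definition firing :: "'v mgraph \<Rightarrow> ('v \<Rightarrow> int) \<Rightarrow> 'v divisor" where
  "firing G f x = (\<Sum>y\<in>verts G. int (mult G x y) * (f y - f x))"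

lemma firing_add: "firing G (\<lambda>x. f x + g x) x = firing G f x + firing G g x"
  unfolding firing_def by (simp add: sum.distrib[symmetric] algebra_simps)

lemma firing_uminus: "firing G (\<lambda>x. - f x) x = - firing G f x"
  unfolding firing_def by (simp add: sum_negf[symmetric] algebra_simps)

lemma firing_shift: "firing G (\<lambda>x. f x + c) x = firing G f x"
  unfolding firing_def by simp

lemma firing_zero [simp]: "firing G (\<lambda>x. 0) x = 0"
  unfolding firing_def by simp

text \<open>\<open>firing G f\<close> is the negative graph Laplacian of the firing script
  \<open>f\<close>. In the difference form it is visible that constants do not matter and that chips
  leave a maximum of \<open>f\<close>.\<close>

lemma lin_equiv_iff_firing:
  "lin_equiv G D D' \<longleftrightarrow> (\<exists>f. \<forall>x\<in>verts G. D' x = D x + firing G f x)"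
proof -
  have "D x - f x * int (valence G x) + (\<Sum>y\<in>verts G. int (mult G x y) * f y) = D x + firing G f x"
    for f :: "_ \<Rightarrow> int" and x
    unfolding firing_def valence_def
    by (simp add: right_diff_distrib sum_subtractf sum_distrib_left mult.commute[of _ "f x"])
  then show ?thesis unfolding lin_equiv_def by (simp only:)
qed

lemma winnable_iff_firing:
  "winnable G D \<longleftrightarrow> (\<exists>f. \<forall>x\<in>verts G. 0 \<le> D x + firing G f x)"
proof
  assume "winnable G D"
  then show "\<exists>f. \<forall>x\<in>verts G. 0 \<le> D x + firing G f x"
    unfolding winnable_def lin_equiv_iff_firing effective_def by force
next
  assume "\<exists>f. \<forall>x\<in>verts G. 0 \<le> D x + firing G f x"
  then obtain f where f: "\<forall>x\<in>verts G. 0 \<le> D x + firing G f x" by blast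
  \<comment> \<open>Outside \<open>verts G\<close> the divisor \<open>D\<close> is arbitrary, hence
    the cut-off at 0.\<close>
  define E where "E = (\<lambda>x. if x \<in> verts G then D x + firing G f x else 0)"
  have "is_divisor G E" "effective G E" "lin_equiv G D E"
    unfolding is_divisor_def effective_def lin_equiv_iff_firing E_def using f by auto
  then show "winnable G D" unfolding winnable_def by blast
qed

lemma winnableI:
  assumes "\<And>x. x \<in> verts G \<Longrightarrow> 0 \<le> D x + firing G f x"
  shows "winnable G D"
  unfolding winnable_iff_firing using assms by (intro exI[of _ f]) simp

lemma winnable_mono:
  assumes "winnable G D" "\<And>x. x \<in> verts G \<Longrightarrow> D x \<le> D' x"
  shows "winnable G D'"
proof -
  obtain f where f: "\<forall>x\<in>verts G. 0 \<le> D x + firing G f x"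
    using assms(1) unfolding winnable_iff_firing by blast
  have "0 \<le> D' x + firing G f x" if "x \<in> verts G" for x
    using f[rule_format, OF that] assms(2)[OF that] by linarith
  then show ?thesis unfolding winnable_iff_firing by blast
qed

lemma winnable_firing:
  assumes "\<And>x. x \<in> verts G \<Longrightarrow> D' x = D x + firing G f x"
  shows "winnable G D' \<longleftrightarrow> winnable G D"
proof
  assume "winnable G D'"
  then obtain h where h: "\<forall>x\<in>verts G. 0 \<le> D' x + firing G h x"
    unfolding winnable_iff_firing by blast
  have "\<forall>x\<in>verts G. 0 \<le> D x + firing G (\<lambda>x. f x + h x) x"
    using h assms by (force simp: firing_add)
  then show "winnable G D" by (intro winnableI[where f = "\<lambda>x. f x + h x"]) simp
next
  assume "winnable G D"
  then obtain h where h: "\<forall>x\<in>verts G. 0 \<le> D x + firing G h x"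
    unfolding winnable_iff_firing by blast
  have "\<forall>x\<in>verts G. 0 \<le> D' x + firing G (\<lambda>x. h x + - f x) x"
    using h assms by (simp only: firing_add firing_uminus) simp
  then show "winnable G D'" by (intro winnableI[where f = "\<lambda>x. h x + - f x"]) simp
qed

lemma rank_firing:
  assumes "\<And>x. x \<in> verts G \<Longrightarrow> D' x = D x + firing G f x"
  shows "rank G D' = rank G D"
proof -
  have 1: "winnable G D' \<longleftrightarrow> winnable G D" by (rule winnable_firing[OF assms])
  have 2: "winnable G (\<lambda>x. D' x - E x) \<longleftrightarrow> winnable G (\<lambda>x. D x - E x)" for E
    by (rule winnable_firing[of _ _ _ f]) (simp add: assms)
  show ?thesis unfolding rank_def 1 2 ..
qed

lemma deg_add: "deg G (\<lambda>x. D x + E x) = deg G D + deg G E"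
  unfolding deg_def by (simp add: sum.distrib)

lemma deg_diff: "deg G (\<lambda>x. D x - E x) = deg G D - deg G E"
  unfolding deg_def by (simp add: sum_subtractf)

lemma deg_mult_pt:
  assumes "finite (verts G)" "v \<in> verts G"
  shows "deg G (\<lambda>x. a * pt v x) = a"
  unfolding deg_def pt_def using assms by (simp add: sum_distrib_left[symmetric])

lemma deg_firing:
  assumes "is_graph G" shows "deg G (firing G f) = 0"
proof -
  have sym: "mult G x y = mult G y x" for x y using assms unfolding is_graph_def by blast
  let ?S = "\<lambda>h. \<Sum>x\<in>verts G. \<Sum>y\<in>verts G. int (mult G x y) * h x y"
  have "?S (\<lambda>x y. f y) = (\<Sum>y\<in>verts G. \<Sum>x\<in>verts G. int (mult G x y) * f y)"
    by (rule sum.swap)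
  also have "\<dots> = ?S (\<lambda>x y. f x)" by (simp add: sym)
  finally show ?thesis
    unfolding deg_def firing_def by (simp add: right_diff_distrib sum_subtractf)
qed

lemma winnable_imp_deg_nonneg:
  assumes "is_graph G" "winnable G D" shows "0 \<le> deg G D"
proof -
  obtain f where f: "\<forall>x\<in>verts G. 0 \<le> D x + firing G f x"
    using assms(2) unfolding winnable_iff_firing by blast
  have "0 \<le> deg G (\<lambda>x. D x + firing G f x)"
    unfolding deg_def using f by (auto intro: sum_nonneg)
  then show ?thesis by (simp add: deg_add deg_firing[OF assms(1)])
qed

text \<open>The \<open>GREATEST\<close> in \<open>rank\<close> is well behaved: the admissible
  \<open>r\<close> contain 0, are bounded by the degree (test with \<open>r\<close> chips at one
  vertex \<open>z\<close>) and are closed downwards (pad \<open>E\<close> with chips at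
  \<open>z\<close>). The strict form with a natural \<open>r\<close> also covers rank -1, and later
  proofs only move the obstruction \<open>E\<close> around.\<close>

lemma rank_less_iff:
  assumes G: "is_graph G"
  shows "rank G D < int r \<longleftrightarrow>
    (\<exists>E. is_divisor G E \<and> effective G E \<and> deg G E = int r \<and> \<not> winnable G (\<lambda>x. D x - E x))"
proof -
  have fin: "finite (verts G)" and "verts G \<noteq> {}" using G unfolding is_graph_def by auto
  then obtain z where z: "z \<in> verts G" by blast
  define P where "P r \<longleftrightarrow> (\<forall>E. is_divisor G E \<and> effective G E \<and> deg G E = int r
                 \<longrightarrow> winnable G (\<lambda>x. D x - E x))" for r
  have Ez: "is_divisor G (\<lambda>x. int r * pt z x)" "effective G (\<lambda>x. int r * pt z x)"
    "deg G (\<lambda>x. int r * pt z x) = int r" for r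
    using z deg_mult_pt[OF fin z] by (auto simp: is_divisor_def effective_def pt_def)
  have main: "rank G D < int r \<longleftrightarrow> \<not> P r"
  proof (cases "winnable G D")
    case False
    have "\<not> winnable G (\<lambda>x. D x - int r * pt z x)"
      using False by (rule contrapos_nn) (erule winnable_mono, simp add: pt_def)
    then have "\<not> P r" using Ez P_def by blast
    then show ?thesis using False unfolding rank_def by simp
  next
    case True
    have 0: "P 0"
    proof -
      have "winnable G (\<lambda>x. D x - E x)" if E: "effective G E" "deg G E = 0" for E
      proof -
        have "\<forall>x\<in>verts G. E x = 0"
          using sum_nonneg_eq_0_iff[OF fin, of E] E unfolding effective_def deg_def by auto
        then show ?thesis using winnable_mono[OF True] by simp
      qed
      then show ?thesis unfolding P_def by simp
    qed
    have bd: "int n \<le> deg G D" if "P n" for n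
    proof -
      have "winnable G (\<lambda>x. D x - int n * pt z x)" using that Ez unfolding P_def by blast
      from winnable_imp_deg_nonneg[OF G this] show ?thesis by (simp add: deg_diff Ez)
    qed
    have down: "P m" if "P n" "m \<le> n" for m n
      unfolding P_def
    proof (intro allI impI, elim conjE)
      fix E assume E: "is_divisor G E" "effective G E" "deg G E = int m"
      let ?E = "\<lambda>x. E x + int (n - m) * pt z x"
      have "is_divisor G ?E" "effective G ?E"
        using E Ez[of "n - m"] unfolding is_divisor_def effective_def by auto
      moreover have "deg G ?E = int n" using E Ez(3)[of "n - m"] \<open>m \<le> n\<close> unfolding deg_add by linarith
      ultimately have "winnable G (\<lambda>x. D x - ?E x)" using \<open>P n\<close> unfolding P_def by blast
      then show "winnable G (\<lambda>x. D x - E x)" by (rule winnable_mono) (simp add: pt_def)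
    qed
    have ub: "n \<le> nat (deg G D)" if "P n" for n using bd[OF that] by linarith
    have Gr: "P (Greatest P)" by (rule GreatestI_nat[of P 0 "nat (deg G D)"]) (use 0 ub in auto)
    have Gr2: "n \<le> Greatest P" if "P n" for n
      by (rule Greatest_le_nat[of P n "nat (deg G D)"]) (use that ub in auto)
    have "rank G D = int (Greatest P)" unfolding rank_def P_def using True by simp
    then show ?thesis using Gr Gr2 down by (metis leD leI of_nat_less_iff)
  qed
  then show ?thesis unfolding P_def by blast
qed

lemma rank_lessE:
  assumes "is_graph G" "rank G D < int r"
  obtains E where "is_divisor G E" "effective G E" "deg G E = int r" "\<not> winnable G (\<lambda>x. D x - E x)"
  using assms rank_less_iff[of G D r] by auto

lemma rank_lessI:
  assumes "is_graph G" "is_divisor G E" "effective G E" "deg G E = int r"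
    "\<not> winnable G (\<lambda>x. D x - E x)"
  shows "rank G D < int r"
  using assms rank_less_iff[of G D r] by auto

lemma rank_ge_minus_one: "-1 \<le> rank G D"
  unfolding rank_def by simp

text \<open>An obstruction \<open>E\<close> for \<open>D + v\<close> is one for \<open>D\<close>; an
  obstruction \<open>E\<close> for \<open>D\<close> becomes the obstruction \<open>E + v\<close> for
  \<open>D + v\<close>.\<close>

lemma rank_add_pt:
  assumes G: "is_graph G" and v: "v \<in> verts G"
  shows "rank G D \<le> rank G (\<lambda>x. D x + pt v x)"
    and "rank G (\<lambda>x. D x + pt v x) \<le> rank G D + 1"
proof -
  have fin: "finite (verts G)" using G unfolding is_graph_def by blast
  let ?D = "\<lambda>x. D x + pt v x"
  show "rank G D \<le> rank G ?D"
  proof -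
    define r where "r = nat (rank G ?D + 1)"
    have r: "int r = rank G ?D + 1" using rank_ge_minus_one[of G ?D] r_def by simp
    have "rank G ?D < int r" using r by simp
    then obtain E where E: "is_divisor G E" "effective G E" "deg G E = int r"
      and n: "\<not> winnable G (\<lambda>x. ?D x - E x)" by (rule rank_lessE[OF G])
    have "\<not> winnable G (\<lambda>x. D x - E x)"
      using n by (rule contrapos_nn) (erule winnable_mono, simp add: pt_def)
    then have "rank G D < int r" using rank_lessI[OF G E] by simp
    then show ?thesis using r by simp
  qed
  show "rank G ?D \<le> rank G D + 1"
  proof -
    define r where "r = nat (rank G D + 1)"
    have r: "int r = rank G D + 1" using rank_ge_minus_one[of G D] r_def by simp
    have "rank G D < int r" using r by simp
    then obtain E where E: "is_divisor G E" "effective G E" "deg G E = int r"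
      and n: "\<not> winnable G (\<lambda>x. D x - E x)" by (rule rank_lessE[OF G])
    let ?E = "\<lambda>x. E x + 1 * pt v x"
    have "is_divisor G ?E" "effective G ?E"
      using E v unfolding is_divisor_def effective_def pt_def by auto
    moreover have "deg G ?E = int (Suc r)"
      unfolding deg_add deg_mult_pt[OF fin v] E(3) by simp
    moreover have "\<not> winnable G (\<lambda>x. ?D x - ?E x)" using n by simp
    ultimately have "rank G ?D < int (Suc r)" by (rule rank_lessI[OF G])
    then show ?thesis using r by simp
  qed
qed

subsection \<open>The rank in large degree\<close>

text \<open>Each edge inside \<open>A\<close> is counted from both ends, which keeps the arithmetic
  free of the \<open>div 2\<close> in \<open>num_edges\<close>.\<close>

definition edge_ends :: "'v mgraph \<Rightarrow> 'v set \<Rightarrow> int" where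
  "edge_ends G A = (\<Sum>x\<in>A. \<Sum>y\<in>A. int (mult G x y))"

lemma edge_ends_insert:
  assumes "is_graph G" "finite A" "x \<notin> A"
  shows "edge_ends G (insert x A) = edge_ends G A + 2 * (\<Sum>y\<in>A. int (mult G x y))"
proof -
  have "mult G y x = mult G x y" for y using assms(1) unfolding is_graph_def by blast
  then have swap: "(\<Sum>y\<in>A. int (mult G y x)) = (\<Sum>y\<in>A. int (mult G x y))" by simp
  have "mult G x x = 0" using assms(1) unfolding is_graph_def by blast
  then show ?thesis unfolding edge_ends_def using assms(2,3)
    by (simp add: sum.distrib swap)
qed

lemma even_edge_ends:
  assumes "is_graph G" "finite A" shows "even (edge_ends G A)"
  using assms(2)
proof (induction A)
  case empty then show ?case by (simp add: edge_ends_def)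
next
  case (insert x A) then show ?case using edge_ends_insert[OF assms(1)] by simp
qed

lemma two_genus:
  assumes "is_graph G"
  shows "2 * genus G = edge_ends G (verts G) - 2 * int (card (verts G)) + 2"
proof -
  have "finite (verts G)" using assms unfolding is_graph_def by blast
  then have "even (edge_ends G (verts G))" using even_edge_ends assms by blast
  moreover have "edge_ends G (verts G) = int (\<Sum>x\<in>verts G. \<Sum>y\<in>verts G. mult G x y)"
    unfolding edge_ends_def by simp
  ultimately show ?thesis unfolding genus_def num_edges_def by (auto simp: zdiv_int)
qed

lemma boundary_edge:
  assumes G: "is_graph G" and "B \<subseteq> verts G" "B \<noteq> {}" "B \<noteq> verts G"
  obtains x y where "x \<in> verts G - B" "y \<in> B" "mult G y x > 0"
proof -
  obtain q where q: "q \<in> B" using assms by blast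
  obtain p where p: "p \<in> verts G" "p \<notin> B" using assms by blast
  have V: "mult G a b > 0 \<Longrightarrow> b \<in> verts G" for a b using G unfolding is_graph_def by blast
  have "(\<lambda>a b. mult G a b > 0)\<^sup>*\<^sup>* q p" using G p(1) q assms(2) unfolding is_graph_def by blast
  then have "p \<notin> B \<longrightarrow> (\<exists>x y. x \<in> verts G - B \<and> y \<in> B \<and> mult G y x > 0)"
  proof induction
    case base then show ?case using q by blast
  next
    case (step y z) then show ?case using V by blast
  qed
  then show ?thesis using p that by blast
qed

text \<open>When a whole set fires, transfers along its inner edges cancel and only boundary edges
  carry chips.\<close>

lemma firing_indicator:
  assumes "finite (verts G)" "B \<subseteq> verts G"
  shows "firing G (\<lambda>x. c * (if x \<in> B then 1 else 0)) x =
    (if x \<in> B then - c * (\<Sum>y\<in>verts G - B. int (mult G x y)) else c * (\<Sum>y\<in>B. int (mult G x y)))"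
proof -
  have "verts G = B \<union> (verts G - B)" using assms by blast
  then have "firing G f x = (\<Sum>y\<in>B. int (mult G x y) * (f y - f x)) +
     (\<Sum>y\<in>verts G - B. int (mult G x y) * (f y - f x))" for f x
    unfolding firing_def using assms
    by (metis (no_types, lifting) sum.subset_diff add.commute)
  then show ?thesis by (simp add: sum_distrib_left sum_distrib_right sum_negf mult.commute)
qed

text \<open>Take \<open>x\<close> adjacent to \<open>B\<close> and first clear all debt outside
  \<open>B\<close> and \<open>x\<close>. Firing \<open>B\<close> often enough then pays the debt of
  \<open>x\<close>, and the other vertices outside \<open>B\<close> can only gain.\<close>

lemma effective_away_from:
  assumes G: "is_graph G" and "B \<subseteq> verts G" "B \<noteq> {}"
  shows "\<exists>f. \<forall>x\<in>verts G - B. 0 \<le> D x + firing G f x"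
  using assms(2,3)
proof (induction "card (verts G - B)" arbitrary: B rule: less_induct)
  case less
  have fin: "finite (verts G)" using G unfolding is_graph_def by blast
  show ?case
  proof (cases "B = verts G")
    case True then show ?thesis by simp
  next
    case False
    then obtain x y where xy: "x \<in> verts G - B" "y \<in> B" "mult G y x > 0"
      using boundary_edge[OF G] less.prems by metis
    have "card (verts G - insert x B) < card (verts G - B)"
      by (rule psubset_card_mono) (use fin xy in auto)
    then obtain f where f: "\<forall>z\<in>verts G - insert x B. 0 \<le> D z + firing G f z"
      using less.hyps[of "insert x B"] less.prems xy by auto
    define c where "c = \<bar>D x + firing G f x\<bar>"
    let ?h = "\<lambda>z. c * (if z \<in> B then 1 else 0)"
    have "mult G x y > 0" using xy G unfolding is_graph_def by metis
    moreover have "finite B" using fin less.prems finite_subset by blast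
    ultimately have "1 \<le> (\<Sum>y\<in>B. int (mult G x y))"
      using member_le_sum[of y B "\<lambda>y. int (mult G x y)"] xy by simp
    then have "c * 1 \<le> c * (\<Sum>y\<in>B. int (mult G x y))"
      by (rule mult_left_mono) (simp add: c_def)
    then have x: "0 \<le> D x + firing G f x + firing G ?h x"
      using firing_indicator[OF fin less.prems(1), of c x] xy c_def by auto
    have "0 \<le> D z + firing G f z + firing G ?h z" if "z \<in> verts G - B" for z
    proof (cases "z = x")
      case True then show ?thesis using x by simp
    next
      case F: False
      have "0 \<le> firing G ?h z"
        using firing_indicator[OF fin less.prems(1), of c z] that
        by (simp add: c_def sum_nonneg)
      then show ?thesis using f F that by force
    qed
    then have "\<forall>z\<in>verts G - B. 0 \<le> D z + firing G (\<lambda>z. f z + ?h z) z"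
      unfolding firing_add by (simp add: add.assoc)
    then show ?thesis by (intro exI[of _ "\<lambda>z. f z + ?h z"])
  qed
qed

text \<open>Dhar's burning argument: fire spreads from the complement of \<open>A\<close>, and a
  vertex burns once it has fewer chips than burnt edges. In burning order each vertex of
  \<open>A\<close> thus has at most (edges to burnt vertices) - 1 chips, and every edge meeting
  \<open>A\<close> is charged once.\<close>

lemma sum_le_if_burnable:
  assumes G: "is_graph G" and "A \<subseteq> verts G"
    and burn: "\<And>B. B \<subseteq> A \<Longrightarrow> B \<noteq> {} \<Longrightarrow> \<exists>x\<in>B. D x < (\<Sum>y\<in>verts G - B. int (mult G x y))"
  shows "2 * (\<Sum>x\<in>A. D x) \<le> edge_ends G (verts G) - edge_ends G (verts G - A) - 2 * int (card A)"
  using assms(2,3)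
proof (induction "card A" arbitrary: A rule: less_induct)
  case less
  have fin: "finite (verts G)" using G unfolding is_graph_def by blast
  then have finA: "finite A" using less.prems finite_subset by blast
  show ?case
  proof (cases "A = {}")
    case True then show ?thesis by simp
  next
    case False
    then obtain x where x: "x \<in> A" "D x < (\<Sum>y\<in>verts G - A. int (mult G x y))"
      using less.prems(2) by blast
    let ?A = "A - {x}"
    have c: "card A = Suc (card ?A)" using finA x by (metis card.remove)
    have IH: "2 * (\<Sum>x\<in>?A. D x) \<le> edge_ends G (verts G) - edge_ends G (verts G - ?A) - 2 * int (card ?A)"
      by (rule less.hyps) (use c less.prems in \<open>auto intro!: less.prems(2)\<close>)
    have "verts G - ?A = insert x (verts G - A)" using x less.prems by blast
    then have "edge_ends G (verts G - ?A) = edge_ends G (verts G - A) + 2 * (\<Sum>y\<in>verts G - A. int (mult G x y))"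
      using edge_ends_insert[OF G, of "verts G - A" x] fin x by auto
    moreover have "(\<Sum>x\<in>A. D x) = D x + (\<Sum>x\<in>?A. D x)" using finA x by (simp add: sum.remove)
    ultimately show ?thesis using IH x(2) c by simp
  qed
qed

text \<open>A non-winnable divisor would be equivalent to a \<open>q\<close>-reduced one with debt
  at \<open>q\<close>. Burning bounds its chips away from \<open>q\<close> by the genus, so its
  degree is smaller than the genus.\<close>

lemma winnable_if_genus_le_deg:
  assumes G: "is_graph G" and d: "genus G \<le> deg G D"
  shows "winnable G D"
proof (rule ccontr)
  assume nw: "\<not> winnable G D"
  have fin: "finite (verts G)" and "verts G \<noteq> {}" using G unfolding is_graph_def by auto
  then obtain q where q: "q \<in> verts G" by blast
  obtain f0 where f0: "\<forall>x\<in>verts G - {q}. 0 \<le> D x + firing G f0 x"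
    using effective_away_from[OF G, of "{q}" D] q by auto
  define D0 where "D0 = (\<lambda>x. D x + firing G f0 x)"
  have nw0: "\<not> winnable G D0" using nw winnable_firing[of G D0 D f0] D0_def by simp
  have degD0: "deg G D0 = deg G D" unfolding D0_def by (simp add: deg_add deg_firing[OF G])
  \<comment> \<open>Scripts that never fire \<open>q\<close> and leave no debt elsewhere. One of
    maximal total size produces the reduced divisor; the next steps show that a maximum
    exists.\<close>
  define F where "F = {f :: 'a \<Rightarrow> nat. f q = 0 \<and> (\<forall>x\<in>verts G - {q}. 0 \<le> D0 x + firing G (\<lambda>x. int (f x)) x)}"
  have F0: "(\<lambda>x. 0) \<in> F" using f0 unfolding F_def D0_def by simp
  have Fq: "D0 q + firing G (\<lambda>x. int (f x)) q < 0" if "f \<in> F" for f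
  proof (rule ccontr)
    assume "\<not> ?thesis"
    then have "\<forall>x\<in>verts G. 0 \<le> D0 x + firing G (\<lambda>x. int (f x)) x"
      using that unfolding F_def by force
    then show False using nw0 unfolding winnable_iff_firing by blast
  qed
  \<comment> \<open>The degree is preserved, only \<open>q\<close> is in debt, and \<open>q\<close>
    never fires, so its debt is no worse than in \<open>D0\<close>. This caps the chips at every
    vertex.\<close>
  have Fub: "D0 x + firing G (\<lambda>x. int (f x)) x \<le> \<bar>deg G D0\<bar> + \<bar>D0 q\<bar>"
    if f: "f \<in> F" and x: "x \<in> verts G" for f x
  proof -
    let ?E = "\<lambda>x. D0 x + firing G (\<lambda>x. int (f x)) x"
    have s: "deg G D0 = ?E q + (\<Sum>x\<in>verts G - {q}. ?E x)"
      using deg_add[of G D0 "firing G (\<lambda>x. int (f x))"] deg_firing[OF G] fin q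
      unfolding deg_def by (simp add: sum.remove)
    have "f q = 0" using f F_def by blast
    then have "0 \<le> firing G (\<lambda>x. int (f x)) q" unfolding firing_def by (simp add: sum_nonneg)
    then have lq: "D0 q \<le> ?E q" by simp
    show ?thesis
    proof (cases "x = q")
      case True then show ?thesis using Fq[OF f] by simp
    next
      case False
      then have "?E x \<le> (\<Sum>x\<in>verts G - {q}. ?E x)"
        by (intro member_le_sum) (use x f fin in \<open>auto simp: F_def\<close>)
      then show ?thesis using s lq by linarith
    qed
  qed
  \<comment> \<open>The bound travels along paths from \<open>q\<close>: each firing of
    \<open>z\<close> sends chips to its neighbour \<open>y\<close>, which fires boundedly often and
    holds boundedly many chips.\<close>
  have bounded: "\<exists>B. \<forall>f\<in>F. f x \<le> B" if x: "x \<in> verts G" for x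
  proof -
    have "(\<lambda>a b. mult G a b > 0)\<^sup>*\<^sup>* q x" using G q x unfolding is_graph_def by blast
    then show ?thesis
    proof induction
      case base then show ?case unfolding F_def by auto
    next
      case (step y z)
      then obtain B where B: "\<forall>f\<in>F. f y \<le> B" by blast
      have yz: "y \<in> verts G" "z \<in> verts G" using step(2) G unfolding is_graph_def by blast+
      define C where "C = \<bar>deg G D0\<bar> + \<bar>D0 q\<bar> + \<bar>D0 y\<bar> + int B * (\<Sum>w\<in>verts G. int (mult G y w))"
      have "f z \<le> nat C" if f: "f \<in> F" for f
      proof -
        have "int (f z) \<le> int (mult G y z) * int (f z)"
          using step(2) mult_right_mono[of 1 "int (mult G y z)" "int (f z)"] by simp
        also have "\<dots> \<le> (\<Sum>w\<in>verts G. int (mult G y w) * int (f w))"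
          by (rule member_le_sum[of z _ "\<lambda>w. int (mult G y w) * int (f w)"]) (use yz fin in auto)
        also have "\<dots> = firing G (\<lambda>x. int (f x)) y + int (f y) * (\<Sum>w\<in>verts G. int (mult G y w))"
          unfolding firing_def by (simp add: right_diff_distrib sum_subtractf sum_distrib_left mult.commute[of _ "int (f y)"])
        also have "\<dots> \<le> firing G (\<lambda>x. int (f x)) y + int B * (\<Sum>w\<in>verts G. int (mult G y w))"
          using B f by (simp add: mult_right_mono sum_nonneg)
        also have "\<dots> \<le> C" using Fub[OF f yz(1)] unfolding C_def by linarith
        finally show ?thesis by simp
      qed
      then show ?case by blast
    qed
  qed
  then obtain B where B: "\<And>f x. f \<in> F \<Longrightarrow> x \<in> verts G \<Longrightarrow> f x \<le> B x" by metis
  have "(\<Sum>x\<in>verts G. f x) < Suc (\<Sum>x\<in>verts G. B x)" if "f \<in> F" for f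
    using B[OF that] by (simp add: sum_mono less_Suc_eq_le)
  then obtain f where f: "f \<in> F"
    and fmax: "\<And>h. h \<in> F \<Longrightarrow> (\<Sum>x\<in>verts G. h x) \<le> (\<Sum>x\<in>verts G. f x)"
    using ex_has_greatest_nat[of "\<lambda>f. f \<in> F" "\<lambda>x. 0" "\<lambda>f. \<Sum>x\<in>verts G. f x" "Suc (\<Sum>x\<in>verts G. B x)"] F0
    by auto
  define E where "E = (\<lambda>x. D0 x + firing G (\<lambda>x. int (f x)) x)"
  have degE: "deg G E = deg G D" unfolding E_def by (simp add: deg_add deg_firing[OF G] degD0)
  \<comment> \<open>Otherwise \<open>A\<close> could fire once more without debt, against the
    maximality of \<open>f\<close>.\<close>
  have red: "\<exists>x\<in>A. E x < (\<Sum>y\<in>verts G - A. int (mult G x y))" if A: "A \<subseteq> verts G - {q}" "A \<noteq> {}" for A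
  proof (rule ccontr)
    assume "\<not> ?thesis"
    then have no: "\<And>x. x \<in> A \<Longrightarrow> (\<Sum>y\<in>verts G - A. int (mult G x y)) \<le> E x" by force
    let ?i = "\<lambda>x. if x \<in> A then 1 else 0 :: nat"
    let ?h = "\<lambda>x. f x + ?i x"
    have AV: "A \<subseteq> verts G" using A by blast
    have hh: "firing G (\<lambda>x. int (?h x)) x = firing G (\<lambda>x. int (f x)) x + firing G (\<lambda>x. 1 * (if x \<in> A then 1 else 0)) x" for x
      unfolding firing_add[symmetric] by (rule arg_cong[where f="\<lambda>g. firing G g x"]) auto
    have "0 \<le> D0 x + firing G (\<lambda>x. int (?h x)) x" if "x \<in> verts G - {q}" for x
    proof (cases "x \<in> A")
      case True
      then show ?thesis using no[OF True] unfolding hh firing_indicator[OF fin AV] E_def by simp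
    next
      case False
      have "0 \<le> D0 x + firing G (\<lambda>x. int (f x)) x" using f that F_def by blast
      moreover have "0 \<le> (\<Sum>y\<in>A. int (mult G x y))" by (simp add: sum_nonneg)
      ultimately show ?thesis using False unfolding hh firing_indicator[OF fin AV] by simp
    qed
    then have "?h \<in> F" using f A unfolding F_def by auto
    from fmax[OF this] have "(\<Sum>x\<in>verts G. ?i x) \<le> 0" by (simp add: sum.distrib)
    moreover obtain a where "a \<in> A" using A by blast
    ultimately show False using fin AV member_le_sum[of a "verts G" ?i] by auto
  qed
  have Vq: "verts G - (verts G - {q}) = {q}" using q by blast
  have "mult G q q = 0" using G unfolding is_graph_def by blast
  then have "2 * (\<Sum>x\<in>verts G - {q}. E x) \<le> edge_ends G (verts G) - 2 * int (card (verts G - {q}))"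
    using sum_le_if_burnable[OF G Diff_subset red, of "{q}"] unfolding Vq
    by (simp add: edge_ends_def[of _ "{q}"])
  moreover have "card (verts G) = Suc (card (verts G - {q}))" using fin q by (metis card.remove)
  ultimately have "(\<Sum>x\<in>verts G - {q}. E x) \<le> genus G" using two_genus[OF G] by simp
  moreover have "deg G E = E q + (\<Sum>x\<in>verts G - {q}. E x)"
    unfolding deg_def using fin q by (simp add: sum.remove)
  ultimately show False using Fq[OF f] degE d unfolding E_def by simp
qed

text \<open>A negative genus would make a divisor of degree -1 winnable.\<close>

lemma genus_nonneg:
  assumes G: "is_graph G" shows "0 \<le> genus G"
proof (rule ccontr)
  assume "\<not> ?thesis"
  moreover obtain z where "z \<in> verts G" "finite (verts G)" using G unfolding is_graph_def by blast
  ultimately have "winnable G (\<lambda>x. (- 1) * pt z x)" "deg G (\<lambda>x. (- 1) * pt z x) = -1"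
    using winnable_if_genus_le_deg[OF G] deg_mult_pt[of G z "-1"] by auto
  then show False using winnable_imp_deg_nonneg[OF G] by fastforce
qed

text \<open>Orient every edge towards the endpoint with larger \<open>p\<close>; \<open>N\<close> is
  indegree minus 1 of this acyclic orientation. Its degree is edges minus vertices.\<close>

lemma exists_nonwinnable:
  assumes G: "is_graph G"
  shows "\<exists>N. deg G N = genus G - 1 \<and> \<not> winnable G N"
proof -
  have fin: "finite (verts G)" "verts G \<noteq> {}" using G unfolding is_graph_def by auto
  obtain p :: "'a \<Rightarrow> nat" where p: "inj_on p (verts G)"
    using finite_imp_inj_to_nat_seg[OF fin(1)] by blast
  define N where "N = (\<lambda>x. (\<Sum>y\<in>{y \<in> verts G. p y < p x}. int (mult G x y)) - 1)"
  have "2 * (\<Sum>x\<in>A. \<Sum>y\<in>{y \<in> A. p y < p x}. int (mult G x y)) = edge_ends G A" if "A \<subseteq> verts G" for A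
  proof -
    have finA: "finite A" using that fin finite_subset by blast
    have sym: "mult G x y = mult G y x" and irr: "mult G x x = 0" for x y
      using G unfolding is_graph_def by blast+
    let ?m = "\<lambda>P. (\<Sum>x\<in>A. \<Sum>y\<in>A. if P x y then int (mult G x y) else 0)"
    have "(\<Sum>x\<in>A. \<Sum>y\<in>{y \<in> A. p y < p x}. int (mult G x y)) = ?m (\<lambda>x y. p y < p x)"
      using finA by (simp add: sum.inter_filter)
    moreover have "?m (\<lambda>x y. p y < p x) = ?m (\<lambda>x y. p x < p y)"
      by (subst sum.swap, intro sum.cong refl) (simp add: sym)
    moreover have "?m (\<lambda>x y. p y < p x) + ?m (\<lambda>x y. p x < p y) = edge_ends G A"
      unfolding edge_ends_def sum.distrib[symmetric]
    proof (intro sum.cong refl)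
      fix x y assume "x \<in> A" "y \<in> A"
      then have "p x = p y \<Longrightarrow> x = y" using p that by (meson inj_onD subsetD)
      then show "(if p y < p x then int (mult G x y) else 0) + (if p x < p y then int (mult G x y) else 0)
         = int (mult G x y)" using irr by (cases "p x" "p y" rule: linorder_cases) auto
    qed
    ultimately show ?thesis by simp
  qed
  from this[OF order.refl] have "deg G N = genus G - 1"
    using two_genus[OF G] unfolding deg_def N_def by (simp add: sum_subtractf)
  moreover have "\<not> winnable G N"
  proof
    assume "winnable G N"
    then obtain f where f: "\<forall>x\<in>verts G. 0 \<le> N x + firing G f x"
      unfolding winnable_iff_firing by blast
    \<comment> \<open>Among the maxima of \<open>f\<close>, the one with least \<open>p\<close>
      loses at least one chip along each incoming edge, which is one more than it has.\<close>
    define M where "M = {x \<in> verts G. \<forall>y\<in>verts G. f y \<le> f x}"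
    have "Max (f ` verts G) \<in> f ` verts G" using fin by simp
    then obtain x0 where "x0 \<in> verts G" "f x0 = Max (f ` verts G)" by auto
    then have "x0 \<in> M" unfolding M_def using fin by simp
    then obtain x where x: "x \<in> M" and xmin: "\<And>y. y \<in> M \<Longrightarrow> p x \<le> p y"
      using ex_has_least_nat[of "\<lambda>x. x \<in> M" x0 p] by blast
    have xV: "x \<in> verts G" using x M_def by blast
    have "firing G f x \<le> (\<Sum>y\<in>verts G. if p y < p x then - int (mult G x y) else 0)"
      unfolding firing_def
    proof (rule sum_mono)
      fix y assume y: "y \<in> verts G"
      have le: "f y \<le> f x" using x y M_def by blast
      show "int (mult G x y) * (f y - f x) \<le> (if p y < p x then - int (mult G x y) else 0)"
      proof (cases "p y < p x")
        case True
        then have "y \<notin> M" using xmin by fastforce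
        then obtain w where "w \<in> verts G" "f y < f w" using y M_def by force
        then have "f y < f x" using x M_def by force
        then have "f y - f x \<le> -1" by simp
        then have "int (mult G x y) * (f y - f x) \<le> int (mult G x y) * (-1)"
          by (intro mult_left_mono) auto
        then show ?thesis using True by simp
      next
        case False then show ?thesis using le by (simp add: mult_nonneg_nonpos)
      qed
    qed
    also have "\<dots> = - (\<Sum>y\<in>{y \<in> verts G. p y < p x}. int (mult G x y))"
      using fin by (simp add: sum.inter_filter[symmetric] sum_negf)
    finally have "N x + firing G f x < 0" unfolding N_def by simp
    then show False using f xV by force
  qed
  ultimately show ?thesis by blast
qed

lemma rank_eq_minus_one_if_deg_neg:
  assumes "is_graph G" "deg G D < 0" shows "rank G D = -1"
  using winnable_imp_deg_nonneg[OF assms(1), of D] assms(2) unfolding rank_def by auto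

text \<open>Riemann's inequality: after removing deg \<open>D\<close> - g chips, g chips are left,
  and these suffice to win.\<close>

lemma rank_ge_deg_minus_genus:
  assumes G: "is_graph G" shows "deg G D - genus G \<le> rank G D"
proof (rule ccontr)
  assume c: "\<not> ?thesis"
  define r where "r = nat (deg G D - genus G)"
  have r: "int r = deg G D - genus G" using c rank_ge_minus_one[of G D] r_def by simp
  then have "rank G D < int r" using c by simp
  then obtain E where E: "deg G E = int r" "\<not> winnable G (\<lambda>x. D x - E x)"
    by (rule rank_lessE[OF G])
  then show False using winnable_if_genus_le_deg[OF G, of "\<lambda>x. D x - E x"] r by (simp add: deg_diff)
qed

text \<open>Let \<open>N\<close> be non-winnable of degree g - 1. Then \<open>D - N\<close> has
  degree at least g, so it is equivalent to an effective \<open>E\<close>. Since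
  \<open>D - E\<close> is equivalent to \<open>N\<close>, this \<open>E\<close> of degree deg
  \<open>D\<close> - g + 1 is an obstruction.\<close>

lemma rank_eq_deg_minus_genus:
  assumes G: "is_graph G" and d: "2 * genus G - 1 \<le> deg G D"
  shows "rank G D = deg G D - genus G"
proof -
  obtain N where N: "deg G N = genus G - 1" "\<not> winnable G N" using exists_nonwinnable[OF G] by blast
  have "winnable G (\<lambda>x. D x - N x)"
    by (rule winnable_if_genus_le_deg[OF G]) (use d N in \<open>simp add: deg_diff\<close>)
  then obtain E f where E: "is_divisor G E" "effective G E"
    and f: "\<forall>x\<in>verts G. E x = D x - N x + firing G f x"
    unfolding winnable_def lin_equiv_iff_firing by blast
  have "deg G E = deg G (\<lambda>x. (D x - N x) + firing G f x)" unfolding deg_def using f by simp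
  then have dE: "deg G E = deg G D - genus G + 1"
    by (simp only: deg_add deg_diff deg_firing[OF G] N)
  moreover have "0 \<le> deg G E" using E unfolding effective_def deg_def by (simp add: sum_nonneg)
  ultimately have dn: "deg G E = int (nat (deg G D - genus G + 1))" by simp
  have "winnable G N \<longleftrightarrow> winnable G (\<lambda>x. D x - E x)"
    by (rule winnable_firing[where f = f]) (use f in auto)
  then have "rank G D < int (nat (deg G D - genus G + 1))"
    using rank_lessI[OF G E dn] N(2) by simp
  then show ?thesis using rank_ge_deg_minus_genus[OF G, of D] dn dE by linarith
qed

subsection \<open>Staircase functions\<close>

text \<open>Such a function \<open>\<rho>\<close> encodes a partition shifted by \<open>c\<close>: its \<open>i\<close>-th part is \<open>c + i - s i\<close>, where \<open>s i\<close> is the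
  least argument at which \<open>\<rho>\<close> exceeds \<open>i\<close>.\<close>

definition staircase :: "int \<Rightarrow> (int \<Rightarrow> int) \<Rightarrow> bool" where
  "staircase c \<rho> \<longleftrightarrow> (\<forall>m. \<rho> m \<le> \<rho> (m + 1) \<and> \<rho> (m + 1) \<le> \<rho> m + 1) \<and>
     (\<exists>L. \<forall>m\<le>L. \<rho> m = 0) \<and> (\<exists>U. \<forall>m\<ge>U. \<rho> m = m - c + 1)"

text \<open>The size of the partition encoded by \<open>\<rho>\<close>, summed along diagonals.\<close>

definition excess :: "int \<Rightarrow> (int \<Rightarrow> int) \<Rightarrow> int" where
  "excess c \<rho> = (\<Sum>m\<in>{m. \<rho> m \<noteq> max 0 (m - c + 1)}. \<rho> m - max 0 (m - c + 1))"

lemma staircase_mono: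
  assumes "staircase c \<rho>" "m \<le> n"
  shows "\<rho> m \<le> \<rho> n" "\<rho> n \<le> \<rho> m + (n - m)"
proof -
  have s: "\<rho> m \<le> \<rho> (m + 1) \<and> \<rho> (m + 1) \<le> \<rho> m + 1" for m
    using assms(1) unfolding staircase_def by blast
  from assms(2) have "\<rho> m \<le> \<rho> n \<and> \<rho> n \<le> \<rho> m + (n - m)"
  proof (induction rule: int_ge_induct)
    case base then show ?case by simp
  next
    case (step i) then show ?case using s[of i] by linarith
  qed
  then show "\<rho> m \<le> \<rho> n" "\<rho> n \<le> \<rho> m + (n - m)" by auto
qed

text \<open>Monotonicity carries the bound 0 from the left end; steps of size at most 1 carry the
  linear bound from the right end.\<close>

lemma staircase_ge:
  assumes "staircase c \<rho>" shows "max 0 (m - c + 1) \<le> \<rho> m"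
proof -
  obtain L U where L: "\<forall>m\<le>L. \<rho> m = 0" and U: "\<forall>m\<ge>U. \<rho> m = m - c + 1"
    using assms unfolding staircase_def by blast
  have "0 \<le> \<rho> m" using staircase_mono(1)[OF assms, of "min L m" m] L by simp
  moreover have "m - c + 1 \<le> \<rho> m" using staircase_mono(2)[OF assms, of m "max U m"] U by simp
  ultimately show ?thesis by simp
qed

lemma staircase_finite_excess:
  assumes "staircase c \<rho>" shows "finite {m. \<rho> m \<noteq> max 0 (m - c + 1)}"
proof -
  obtain L U where L: "\<forall>m\<le>L. \<rho> m = 0" and U: "\<forall>m\<ge>U. \<rho> m = m - c + 1"
    using assms unfolding staircase_def by blast
  have "{m. \<rho> m \<noteq> max 0 (m - c + 1)} \<subseteq> {min L (c - 1)..max U (c - 1)}"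
  proof
    fix m assume m: "m \<in> {m. \<rho> m \<noteq> max 0 (m - c + 1)}"
    have "\<not> m < min L (c - 1)" using L m by auto
    moreover have "\<not> m > max U (c - 1)" using U m by auto
    ultimately show "m \<in> {min L (c - 1)..max U (c - 1)}" by (simp only: atLeastAtMost_iff not_less)
  qed
  then show ?thesis by (rule finite_subset) simp
qed

lemma excess_eq_sum:
  assumes "finite A" "{m. \<rho> m \<noteq> max 0 (m - c + 1)} \<subseteq> A"
  shows "excess c \<rho> = (\<Sum>m\<in>A. \<rho> m - max 0 (m - c + 1))"
  unfolding excess_def by (rule sum.mono_neutral_left) (use assms in auto)

lemma staircase_unique:
  assumes "staircase c \<rho>" "staircase c' \<rho>" shows "c = c'"
proof -
  obtain U U' where "\<forall>m\<ge>U. \<rho> m = m - c + 1" "\<forall>m\<ge>U'. \<rho> m = m - c' + 1"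
    using assms unfolding staircase_def by blast
  then have "max U U' - c + 1 = max U U' - c' + 1" by (metis max.cobounded1 max.cobounded2)
  then show ?thesis by simp
qed

text \<open>Rising just after \<open>l\<close> keeps \<open>\<rho>\<close> positive from there on.
  Being flat just before \<open>l'\<close> puts \<open>\<rho>\<close> at least one above the line
  \<open>m - c + 1\<close> at \<open>l' - 1\<close>, hence everywhere to the left of it. So each of
  the \<open>l' - l - 1\<close> diagonals in between contributes a box.\<close>

lemma excess_ge_corner_distance:
  assumes \<rho>: "staircase c \<rho>" and "l < l'" "\<rho> (l + 1) = \<rho> l + 1" "\<rho> (l' - 1) = \<rho> l'"
  shows "l' - l - 1 \<le> excess c \<rho>"
proof -
  let ?e = "\<lambda>m. \<rho> m - max 0 (m - c + 1)"
  let ?S = "{m. \<rho> m \<noteq> max 0 (m - c + 1)}"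
  have fin: "finite (?S \<union> {l + 1..l' - 1})" using staircase_finite_excess[OF \<rho>] by simp
  have "1 \<le> ?e z" if "z \<in> {l + 1..l' - 1}" for z
  proof -
    have "0 \<le> \<rho> l" using staircase_ge[OF \<rho>, of l] by simp
    then have "1 \<le> \<rho> z" using staircase_mono(1)[OF \<rho>, of "l + 1" z] that assms by simp
    moreover have "z - c + 2 \<le> \<rho> z"
      using staircase_mono(2)[OF \<rho>, of z "l' - 1"] staircase_ge[OF \<rho>, of l'] that assms by simp
    ultimately show ?thesis by simp
  qed
  then have "(\<Sum>z\<in>{l + 1..l' - 1}. 1) \<le> (\<Sum>z\<in>{l + 1..l' - 1}. ?e z)" by (rule sum_mono)
  also have "\<dots> \<le> (\<Sum>z\<in>?S \<union> {l + 1..l' - 1}. ?e z)"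
    by (rule sum_mono2) (use fin staircase_ge[OF \<rho>] in auto)
  also have "\<dots> = excess c \<rho>" by (rule excess_eq_sum[symmetric]) (use fin in auto)
  finally show ?thesis using assms(2) by simp
qed

subsection \<open>Inversions of periodic permutations\<close>

text \<open>A relation, since the minimum ranges over all integers and its attainment has to be
  carried along.\<close>

definition is_minimum :: "(int \<Rightarrow> int) \<Rightarrow> int \<Rightarrow> bool" where
  "is_minimum F q \<longleftrightarrow> (\<forall>m. q \<le> F m) \<and> (\<exists>m. F m = q)"

lemma is_minimum_exists:
  assumes "\<And>m. 0 \<le> F m" shows "\<exists>q. is_minimum F q"
proof -
  obtain m where "\<And>n. nat (F m) \<le> nat (F n)"
    using ex_has_least_nat[of "\<lambda>_. True" undefined "\<lambda>m. nat (F m)"] by blast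
  then have "is_minimum F (F m)" unfolding is_minimum_def using assms
    by (metis nat_mono_iff not_le_imp_less order.strict_trans2 leD)
  then show ?thesis by blast
qed

lemma is_minimum_unique: "is_minimum F q \<Longrightarrow> is_minimum F q' \<Longrightarrow> q = q'"
  unfolding is_minimum_def by (metis order.antisym)

lemma is_minimum_min:
  assumes "is_minimum F p" "is_minimum F' p'"
  shows "is_minimum (\<lambda>m. min (F m) (F' m + 1)) (min p (p' + 1))"
proof -
  obtain m m' where m: "F m = p" "F' m' = p'" and le: "\<And>n. p \<le> F n" "\<And>n. p' \<le> F' n"
    using assms unfolding is_minimum_def by blast
  have "min p (p' + 1) \<le> min (F n) (F' n + 1)" for n using le[of n] by linarith
  moreover have "\<exists>n. min (F n) (F' n + 1) = min p (p' + 1)"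
  proof (cases "p \<le> p' + 1")
    case True then show ?thesis using m le(2)[of m] le(1)[of m] by (intro exI[of _ m]) linarith
  next
    case False then show ?thesis using m le(1)[of m'] by (intro exI[of _ m']) linarith
  qed
  ultimately show ?thesis unfolding is_minimum_def by blast
qed

text \<open>The rank function of the permutation matrix of \<open>\<tau>\<close>, as used for Bruhat
  order: dots in a quadrant. For periodic \<open>\<tau>\<close> the set is finite, so
  \<open>card\<close> is meaningful.\<close>

definition dominance :: "(int \<Rightarrow> int) \<Rightarrow> int \<Rightarrow> int \<Rightarrow> int" where
  "dominance \<tau> a b = int (card {j. b \<le> j \<and> \<tau> j \<le> a})"

definition periodic :: "int \<Rightarrow> (int \<Rightarrow> int) \<Rightarrow> bool" where
  "periodic k \<tau> \<longleftrightarrow> (\<forall>x. \<tau> (x + k) = \<tau> x + k)"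

lemma periodic_mult:
  assumes "periodic k \<tau>" shows "\<tau> (x + j * k) = \<tau> x + j * k"
proof (induction j rule: int_induct[of _ 0])
  case base then show ?case by simp
next
  case (step1 i)
  have "\<tau> (x + i * k + k) = \<tau> (x + i * k) + k" using assms unfolding periodic_def by blast
  then show ?case using step1 by (simp add: algebra_simps)
next
  case (step2 i)
  have "\<tau> (x + (i - 1) * k + k) = \<tau> (x + (i - 1) * k) + k" using assms unfolding periodic_def by blast
  then show ?case using step2 by (simp add: algebra_simps)
qed

text \<open>\<open>\<tau> j - j\<close> depends on \<open>j\<close> mod \<open>k\<close> alone, so
  it is bounded below by its minimum over one period.\<close>

lemma finite_dominance:
  assumes "periodic k \<tau>" "0 < k" shows "finite {j. b \<le> j \<and> \<tau> j \<le> a}"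
proof -
  define B where "B = Min ((\<lambda>x. \<tau> x - x) ` {0..<k})"
  have "{j. b \<le> j \<and> \<tau> j \<le> a} \<subseteq> {b..a - B}"
  proof
    fix j assume j: "j \<in> {j. b \<le> j \<and> \<tau> j \<le> a}"
    have "B \<le> \<tau> (j mod k) - j mod k" unfolding B_def using assms(2) by (intro Min_le) auto
    moreover have "\<tau> j = \<tau> (j mod k) + j div k * k"
      using periodic_mult[OF assms(1), of "j mod k" "j div k"] by simp
    ultimately have "B \<le> \<tau> j - j" using mod_div_mult_eq[of j k] by linarith
    then show "j \<in> {b..a - B}" using j by simp
  qed
  then show ?thesis by (rule finite_subset) simp
qed

lemma dominance_step:
  assumes "periodic k \<tau>" "0 < k"
  shows "dominance \<tau> a b = dominance \<tau> a (b + 1) + (if \<tau> b \<le> a then 1 else 0)"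
proof (cases "\<tau> b \<le> a")
  case True
  then have "{j. b \<le> j \<and> \<tau> j \<le> a} = insert b {j. b + 1 \<le> j \<and> \<tau> j \<le> a}" by auto
  then show ?thesis using True finite_dominance[OF assms] unfolding dominance_def by simp
next
  case False
  have "{j. b \<le> j \<and> \<tau> j \<le> a} = {j. b + 1 \<le> j \<and> \<tau> j \<le> a}"
    using False by (auto simp: le_less)
  then show ?thesis using False unfolding dominance_def by simp
qed

text \<open>A transversal of the \<open>k\<close>-equivalence classes. The start \<open>i\<close> is
  left free so that the induction can put it at a descent.\<close>

definition inversion_window :: "int \<Rightarrow> (int \<Rightarrow> int) \<Rightarrow> int \<Rightarrow> (int \<times> int) set" where
  "inversion_window k \<tau> i = {(a, b). i \<le> a \<and> a < i + k \<and> a < b \<and> \<tau> a > \<tau> b}"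

lemma inv_k_eq_card_window:
  assumes per: "periodic k \<tau>" and k: "0 < k"
  shows "inv_k k \<tau> = (if finite (inversion_window k \<tau> i)
    then enat (card (inversion_window k \<tau> i)) else \<infinity>)"
proof -
  let ?I = "inversions \<tau>" and ?W = "inversion_window k \<tau> i"
  define r where "r = k_equiv k \<inter> (?I \<times> ?I)"
  have eq: "equiv ?I r"
  proof (rule equivI)
    show "r \<subseteq> ?I \<times> ?I" unfolding r_def by blast
    show "refl_on ?I r" unfolding refl_on_def r_def k_equiv_def by auto
    show "sym r" unfolding sym_def r_def k_equiv_def by (auto simp: dvd_diff_commute)
    show "trans r"
    proof (rule transI)
      fix p q s assume "(p, q) \<in> r" "(q, s) \<in> r"
      moreover have "k dvd x - z" if "k dvd x - y" "k dvd y - z" for x y z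
        using dvd_add[OF that] by simp
      ultimately show "(p, s) \<in> r" unfolding r_def k_equiv_def by (auto simp: algebra_simps)
    qed
  qed
  have WI: "?W \<subseteq> ?I" unfolding inversion_window_def inversions_def by auto
  have "bij_betw (\<lambda>p. r `` {p}) ?W (?I // r)"
  proof (rule bij_betw_imageI)
    show "inj_on (\<lambda>p. r `` {p}) ?W"
    proof (rule inj_onI)
      fix p q assume p: "p \<in> ?W" and q: "q \<in> ?W" and "r `` {p} = r `` {q}"
      then have "(p, q) \<in> r" using eq_equiv_class_iff[OF eq] WI by blast
      moreover obtain a b a' b' where ab: "p = (a, b)" "q = (a', b')" by fastforce
      ultimately have "a - a' = b - b'" "k dvd a - a'" unfolding r_def k_equiv_def by auto
      moreover have "\<bar>a - a'\<bar> < k" using p q ab unfolding inversion_window_def by auto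
      ultimately have "a - a' = 0" using zdvd_not_zless[of "\<bar>a - a'\<bar>" k] by auto
      then show "p = q" using ab \<open>a - a' = b - b'\<close> by simp
    qed
    show "(\<lambda>p. r `` {p}) ` ?W = ?I // r"
    proof
      show "(\<lambda>p. r `` {p}) ` ?W \<subseteq> ?I // r" using WI by (auto simp: quotient_def)
      show "?I // r \<subseteq> (\<lambda>p. r `` {p}) ` ?W"
      proof
        fix X assume "X \<in> ?I // r"
        then obtain a b where ab: "(a, b) \<in> ?I" "X = r `` {(a, b)}"
          by (auto simp: quotient_def)
        define j where "j = - ((a - i) div k)"
        have "a + j * k - i = (a - i) mod k"
          unfolding j_def by (simp add: minus_div_mult_eq_mod[symmetric])
        then have w: "i \<le> a + j * k" "a + j * k < i + k"
          using pos_mod_sign[OF k, of "a - i"] pos_mod_bound[OF k, of "a - i"] by linarith+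
        let ?p = "(a + j * k, b + j * k)"
        have p: "?p \<in> ?W" using ab(1) w unfolding inversion_window_def inversions_def
          by (simp add: periodic_mult[OF per])
        moreover have "((a, b), ?p) \<in> r" using p ab(1) WI unfolding r_def k_equiv_def by auto
        ultimately show "X \<in> (\<lambda>p. r `` {p}) ` ?W" using ab(2) equiv_class_eq[OF eq] by blast
      qed
    qed
  qed
  then have "finite ?W \<longleftrightarrow> finite (?I // r)" "card ?W = card (?I // r)"
    by (auto simp: bij_betw_finite bij_betw_same_card)
  then show ?thesis unfolding inv_k_def r_def by (simp add: Let_def)
qed

text \<open>The simple reflection of the affine symmetric group exchanging \<open>i + j k\<close>
  with \<open>i + 1 + j k\<close> for every \<open>j\<close>.\<close>

definition affine_swap :: "int \<Rightarrow> int \<Rightarrow> int \<Rightarrow> int" where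
  "affine_swap k i x = (if k dvd x - i then x + 1 else if k dvd x - i - 1 then x - 1 else x)"

text \<open>For \<open>k \<ge> 2\<close> the two residue classes that move are disjoint. The only
  pairs put out of order are the exchanged neighbours themselves.\<close>

lemma affine_swap_props:
  assumes k: "2 \<le> k"
  shows affine_swap_involution: "affine_swap k i (affine_swap k i x) = x"
    and affine_swap_periodic: "periodic k (affine_swap k i)"
    and affine_swap_less: "a < b \<Longrightarrow> \<not> (k dvd a - i \<and> b = a + 1) \<Longrightarrow> affine_swap k i a < affine_swap k i b"
    and affine_swap_window: "i \<le> a \<Longrightarrow> a < i + k \<Longrightarrow> i \<le> affine_swap k i a \<and> affine_swap k i a < i + k"
proof -
  have n: "\<not> (k dvd y \<and> k dvd y - 1)" for y
  proof
    assume "k dvd y \<and> k dvd y - 1"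
    then have "k dvd y - (y - 1)" using dvd_diff by blast
    then show False using k zdvd_not_zless[of 1 k] by auto
  qed
  show "affine_swap k i (affine_swap k i x) = x"
    using n[of "x - i"] n[of "x + 1 - i"] unfolding affine_swap_def
    by (auto simp: algebra_simps)
  have "k dvd x + k - y \<longleftrightarrow> k dvd x - y" for x y
    using dvd_add_left_iff[of k k "x - y"] by (simp add: algebra_simps)
  from this[of _ i] this[of _ "i + 1"] show "periodic k (affine_swap k i)"
    unfolding periodic_def affine_swap_def by (simp add: algebra_simps)
  show "affine_swap k i a < affine_swap k i b" if ab: "a < b" "\<not> (k dvd a - i \<and> b = a + 1)"
  proof -
    consider "b = a + 1" | "b = a + 2" | "a + 3 \<le> b" using ab(1) by linarith
    then show ?thesis
    proof cases
      case 1 then show ?thesis using ab(2) unfolding affine_swap_def by (auto simp: algebra_simps)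
    next
      case 2 then show ?thesis using n[of "a + 1 - i"] unfolding affine_swap_def
        by (auto simp: algebra_simps)
    next
      case 3 then show ?thesis unfolding affine_swap_def by auto
    qed
  qed
  show "i \<le> affine_swap k i a \<and> affine_swap k i a < i + k" if "i \<le> a" "a < i + k"
  proof -
    have 1: "a = i" if "k dvd a - i" using zdvd_not_zless[of "a - i" k] that \<open>i \<le> a\<close> \<open>a < i + k\<close> by fastforce
    have 2: "a \<noteq> i" if "k dvd a - i - 1" using that n[of "a - i"] by auto
    show ?thesis using 1 2 that k unfolding affine_swap_def by auto
  qed
qed

text \<open>Undoing a descent destroys the class of \<open>(i, i + 1)\<close> and relabels all other
  inversions by \<open>s\<close>. The window starts at \<open>i\<close> because \<open>s\<close>
  then maps it to itself.\<close>

lemma inversion_window_affine_swap: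
  assumes per: "periodic k \<tau>" and k: "2 \<le> k" and desc: "\<tau> (i + 1) < \<tau> i"
  defines "s \<equiv> affine_swap k i"
  shows "inversion_window k \<tau> i =
      insert (i, i + 1) ((\<lambda>(a, b). (s a, s b)) ` inversion_window k (\<tau> \<circ> s) i)"
    and "(i, i + 1) \<notin> (\<lambda>(a, b). (s a, s b)) ` inversion_window k (\<tau> \<circ> s) i"
    and "inj_on (\<lambda>(a, b). (s a, s b)) (inversion_window k (\<tau> \<circ> s) i)"
proof -
  note ss = affine_swap_involution[OF k, of i, folded s_def]
  note sl = affine_swap_less[OF k, of _ _ i, folded s_def]
  note sw = affine_swap_window[OF k, of i, folded s_def]
  have si: "s i = i + 1" "s (i + 1) = i" using ss[of i] by (auto simp: s_def affine_swap_def)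
  have desc': "\<tau> (a + 1) < \<tau> a" if "k dvd a - i" for a
  proof -
    obtain j where "a - i = k * j" using \<open>k dvd a - i\<close> by (rule dvdE)
    then have "a = i + j * k" "a + 1 = (i + 1) + j * k" by (auto simp: algebra_simps)
    then have "\<tau> a = \<tau> i + j * k" "\<tau> (a + 1) = \<tau> (i + 1) + j * k" by (metis periodic_mult[OF per])+
    then show ?thesis using desc by simp
  qed
  show "inversion_window k \<tau> i =
      insert (i, i + 1) ((\<lambda>(a, b). (s a, s b)) ` inversion_window k (\<tau> \<circ> s) i)" (is "?L = ?R")
  proof
    show "?L \<subseteq> ?R"
    proof
      fix p assume p: "p \<in> ?L"
      then obtain a b where ab: "p = (a, b)" "i \<le> a" "a < i + k" "a < b" "\<tau> b < \<tau> a"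
        unfolding inversion_window_def by auto
      show "p \<in> ?R"
      proof (cases "k dvd a - i \<and> b = a + 1")
        case True
        then have "a = i" using zdvd_not_zless[of "a - i" k] ab by fastforce
        then show ?thesis using True ab by simp
      next
        case False
        then have "(s a, s b) \<in> inversion_window k (\<tau> \<circ> s) i"
          unfolding inversion_window_def using ab sl[OF ab(4)] sw[OF ab(2,3)] by (simp add: ss)
        then show ?thesis using ab(1) ss by (force simp: image_iff)
      qed
    qed
    show "?R \<subseteq> ?L"
    proof
      fix p assume "p \<in> ?R"
      then consider "p = (i, i + 1)" |
        a b where "p = (s a, s b)" "i \<le> a" "a < i + k" "a < b" "\<tau> (s b) < \<tau> (s a)"
        unfolding inversion_window_def by auto
      then show "p \<in> ?L"
      proof cases
        case 1 then show ?thesis using desc k unfolding inversion_window_def by simp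
      next
        case (2 a b)
        have "\<not> (k dvd a - i \<and> b = a + 1)"
        proof
          assume c: "k dvd a - i \<and> b = a + 1"
          then have "s a = a + 1" "s b = a"
            using ss[of a] by (auto simp: s_def affine_swap_def)
          then show False using desc'[of a] c 2(5) by simp
        qed
        then show ?thesis using 2 sl[of a b] sw[of a] unfolding inversion_window_def by simp
      qed
    qed
  qed
  show "(i, i + 1) \<notin> (\<lambda>(a, b). (s a, s b)) ` inversion_window k (\<tau> \<circ> s) i"
  proof
    assume "(i, i + 1) \<in> (\<lambda>(a, b). (s a, s b)) ` inversion_window k (\<tau> \<circ> s) i"
    then obtain a b where "s a = i" "s b = i + 1" "a < b" unfolding inversion_window_def by auto
    then have "a = i + 1" "b = i" using ss[of a] ss[of b] si by auto
    then show False using \<open>a < b\<close> by simp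
  qed
  show "inj_on (\<lambda>(a, b). (s a, s b)) (inversion_window k (\<tau> \<circ> s) i)"
    by (rule inj_onI) (auto, (metis ss)+)
qed

text \<open>A strictly increasing bijection can skip no value, so \<open>\<tau> i + 1\<close> is
  attained right after \<open>i\<close>. Shifts are the length-zero elements of the extended affine
  symmetric group, where the induction below ends.\<close>

lemma no_descent_imp_shift:
  fixes \<tau> :: "int \<Rightarrow> int"
  assumes "bij \<tau>" and nd: "\<And>i. \<tau> i \<le> \<tau> (i + 1)"
  shows "\<tau> x = x + \<tau> 0"
proof -
  have st: "\<tau> i < \<tau> (i + 1)" for i
  proof -
    have "\<tau> i \<noteq> \<tau> (i + 1)" using assms(1) by (simp add: bij_def inj_eq)
    then show ?thesis using nd[of i] by simp
  qed
  have mono: "\<tau> i \<le> \<tau> j" if "i \<le> j" for i j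
    using that by (induction rule: int_ge_induct) (auto intro: order.trans nd)
  have one: "\<tau> (i + 1) = \<tau> i + 1" for i
  proof -
    obtain j where j: "\<tau> j = \<tau> i + 1" using assms(1) by (metis bij_def surj_def)
    have "i < j" using mono[of j i] j by force
    then show ?thesis using mono[of "i + 1" j] st[of i] j by simp
  qed
  show ?thesis
  proof (induction x rule: int_induct[of _ 0])
    case base then show ?case by simp
  next
    case (step1 i) then show ?case using one[of i] by simp
  next
    case (step2 i) then show ?case using one[of "i - 1"] by simp
  qed
qed

section \<open>Shifts and simple transpositions acting on staircases\<close>

lemma staircase_shift:
  assumes "staircase c \<rho>"
  shows "staircase (c + t) (\<lambda>l. \<rho> (l - t))" "excess (c + t) (\<lambda>l. \<rho> (l - t)) = excess c \<rho>"
proof -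
  obtain L U where L: "\<forall>m\<le>L. \<rho> m = 0" and U: "\<forall>m\<ge>U. \<rho> m = m - c + 1"
    using assms unfolding staircase_def by blast
  have "\<rho> (m - t) \<le> \<rho> (m + 1 - t) \<and> \<rho> (m + 1 - t) \<le> \<rho> (m - t) + 1" for m
    using staircase_mono[OF assms, of "m - t" "m + 1 - t"] by simp
  then show "staircase (c + t) (\<lambda>l. \<rho> (l - t))" unfolding staircase_def
    using L U by (intro conjI allI exI[of _ "L + t"] exI[of _ "U + t"]) auto
  let ?S = "{m. \<rho> m \<noteq> max 0 (m - c + 1)}"
  have "bij_betw (\<lambda>m. m + t) ?S {m. \<rho> (m - t) \<noteq> max 0 (m - (c + t) + 1)}"
    by (rule bij_betw_byWitness[where f' = "\<lambda>m. m - t"]) (auto simp: algebra_simps)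
  from sum.reindex_bij_betw[OF this, of "\<lambda>m. \<rho> (m - t) - max 0 (m - (c + t) + 1)"]
  show "excess (c + t) (\<lambda>l. \<rho> (l - t)) = excess c \<rho>"
    unfolding excess_def by (simp add: algebra_simps)
qed

text \<open>The swap permutes the half-line \<open>j \<ge> b\<close> unless the cut at
  \<open>b\<close> separates an exchanged pair.\<close>

lemma dominance_affine_swap:
  assumes k: "2 \<le> k" and b: "\<not> k dvd b - i - 1"
  shows "dominance (\<tau> \<circ> affine_swap k i) a b = dominance \<tau> a b"
proof -
  let ?s = "affine_swap k i"
  note ss = affine_swap_involution[OF k, of i]
  have ge: "b \<le> ?s j" if "b \<le> j" for j
    using that b by (cases "j = b") (auto simp: affine_swap_def)
  have "bij_betw ?s {j. b \<le> j \<and> (\<tau> \<circ> ?s) j \<le> a} {j. b \<le> j \<and> \<tau> j \<le> a}"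
    by (rule bij_betw_byWitness[where f' = ?s]) (auto simp: ss ge)
  then show ?thesis unfolding dominance_def by (simp add: bij_betw_same_card)
qed

text \<open>Applying a simple transposition of the affine symmetric group can add a box at every corner of
  one residue class mod \<open>k\<close>; two such corners already force at least \<open>k - 1\<close> boxes in between.\<close>

lemma staircase_affine_push:
  assumes Q': "staircase c Q'" and k: "2 \<le> k" and small: "excess c Q' < k - 1"
    and on: "\<And>l. k dvd l - i \<Longrightarrow> Q l = min (Q' (l + 1)) (Q' (l - 1) + 1)"
    and off: "\<And>l. \<not> k dvd l - i \<Longrightarrow> Q l = Q' l"
  shows "staircase c Q" "excess c Q \<le> excess c Q' + 1"
proof -
  have st: "Q' m \<le> Q' (m + 1) \<and> Q' (m + 1) \<le> Q' m + 1" for m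
    using Q' unfolding staircase_def by blast
  have st': "Q' (m - 1) \<le> Q' m \<and> Q' m \<le> Q' (m - 1) + 1" for m
    using st[of "m - 1"] by simp
  \<comment> \<open>The addable corners of residue \<open>i\<close>: the minimum in
    \<open>on\<close> exceeds \<open>Q' l\<close> exactly where \<open>Q'\<close> is flat before
    \<open>l\<close> and rises after it.\<close>
  define J where "J = {l. k dvd l - i \<and> Q' (l - 1) = Q' l \<and> Q' (l + 1) = Q' l + 1}"
  have QJ: "Q l = Q' l + (if l \<in> J then 1 else 0)" for l
    using on[of l] off[of l] st[of l] st'[of l] unfolding J_def
    by (cases "k dvd l - i") auto
  obtain L U where L: "\<forall>m\<le>L. Q' m = 0" and U: "\<forall>m\<ge>U. Q' m = m - c + 1"
    using Q' unfolding staircase_def by blast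
  have nJ: "l \<notin> J" if "l \<le> L - 1 \<or> U + 1 \<le> l" for l
    using that
  proof
    assume "l \<le> L - 1" then show ?thesis using L unfolding J_def by simp
  next
    assume "U + 1 \<le> l"
    then have "Q' l = l - c + 1" "Q' (l - 1) = (l - 1) - c + 1" using U by auto
    then show ?thesis unfolding J_def by simp
  qed
  \<comment> \<open>Raising a corner swaps its flat and its rising side, and neighbouring positions
    cannot both be corners.\<close>
  have "Q m \<le> Q (m + 1) \<and> Q (m + 1) \<le> Q m + 1" for m
    using st[of m] QJ[of m] QJ[of "m + 1"] unfolding J_def by auto
  then show stQ: "staircase c Q" unfolding staircase_def
    using L U nJ QJ by (intro conjI allI exI[of _ "L - 1"] exI[of _ "U + 1"]) auto
  have uniq: "l = l'" if "l \<in> J" "l' \<in> J" "l \<le> l'" for l l'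
  proof (rule ccontr)
    assume "l \<noteq> l'"
    then have less: "l < l'" using that by simp
    have "k dvd (l' - i) - (l - i)" using that dvd_diff unfolding J_def by blast
    then have "k \<le> l' - l" using less zdvd_imp_le[of k "l' - l"] by simp
    moreover have "l' - l - 1 \<le> excess c Q'"
      by (rule excess_ge_corner_distance[OF Q' less]) (use that in \<open>auto simp: J_def\<close>)
    ultimately show False using small by simp
  qed
  have "J \<subseteq> {L..U}"
  proof
    fix l assume "l \<in> J"
    then have "\<not> (l \<le> L - 1 \<or> U + 1 \<le> l)" using nJ by blast
    then show "l \<in> {L..U}" by simp
  qed
  then have finJ: "finite J" by (rule finite_subset) simp
  have "card J \<le> 1"
  proof (rule ccontr)
    assume "\<not> ?thesis"
    then have "1 < card J" by simp
    then obtain l l' where "l \<in> J" "l' \<in> J" "l \<noteq> l'"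
      by (metis card_le_Suc0_iff_eq finJ One_nat_def not_less)
    then show False using uniq[of l l'] uniq[of l' l] by linarith
  qed
  let ?A = "{m. Q m \<noteq> max 0 (m - c + 1)} \<union> {m. Q' m \<noteq> max 0 (m - c + 1)} \<union> J"
  have finA: "finite ?A" using staircase_finite_excess[OF Q'] staircase_finite_excess[OF stQ] finJ by simp
  have "excess c Q = (\<Sum>m\<in>?A. (Q' m - max 0 (m - c + 1)) + (if m \<in> J then 1 else 0))"
    by (subst excess_eq_sum[OF finA]) (auto simp: QJ intro!: sum.cong)
  also have "\<dots> = excess c Q' + (\<Sum>m\<in>?A. if m \<in> J then 1 else 0)"
    unfolding sum.distrib by (subst excess_eq_sum[OF finA]) auto
  also have "(\<Sum>m\<in>?A. if m \<in> J then 1 else 0) = int (card J)"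
  proof -
    have "?A \<inter> J = J" by blast
    then show ?thesis using finA by (simp add: sum.If_cases)
  qed
  finally show "excess c Q \<le> excess c Q' + 1" using \<open>card J \<le> 1\<close> by simp
qed

text \<open>Induction on the number of inversion classes. Removing a transposition at a descent
  changes \<open>dominance\<close> only in the rows of one residue, where the old row is a minimum
  of its two neighbours. This survives the minimum over \<open>m\<close>, so \<open>Q\<close> arises
  from \<open>Q'\<close> exactly as in \<open>staircase_affine_push\<close>.\<close>

theorem excess_dominance_product:
  assumes \<rho>: "staircase c \<rho>" and k: "0 < k"
    and "bij \<tau>" "periodic k \<tau>" "inv_k k \<tau> = enat n" "excess c \<rho> + int n < k"
    and "\<And>l. is_minimum (\<lambda>m. \<rho> (m - 1) + dominance \<tau> (- m) (- l)) (Q l)"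
  shows "\<exists>c'. staircase c' Q \<and> excess c' Q \<le> excess c \<rho> + int n"
  using assms(3-)
proof (induction n arbitrary: \<tau> Q rule: less_induct)
  case (less n)
  note per = less.prems(2) and Q = less.prems(5)
  show ?case
  proof (cases "\<exists>i. \<tau> (i + 1) < \<tau> i")
    case False
    then obtain t where sh: "\<And>j. \<tau> j = j + t"
      using no_descent_imp_shift[OF less.prems(1)] by (meson not_less)
    have "Q l = \<rho> (l - t)" for l
    proof -
      have dom: "dominance \<tau> a b = max 0 (a - t - b + 1)" for a b
      proof -
        have "{j. b \<le> j \<and> \<tau> j \<le> a} = {b..a - t}" by (auto simp: sh)
        then show ?thesis unfolding dominance_def by simp
      qed
      \<comment> \<open>At \<open>m = l - t + 1\<close> the dot count is 0. For smaller
        \<open>m\<close> it grows by one per step, at least as fast as \<open>\<rho>\<close>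
        falls.\<close>
      have "is_minimum (\<lambda>m. \<rho> (m - 1) + dominance \<tau> (- m) (- l)) (\<rho> (l - t))"
        unfolding is_minimum_def dom
      proof (intro conjI allI exI[of _ "l - t + 1"])
        fix m
        show "\<rho> (l - t) \<le> \<rho> (m - 1) + max 0 (- m - t - - l + 1)"
        proof (cases "l - t \<le> m - 1")
          case True then show ?thesis using staircase_mono(1)[OF \<rho> True] by simp
        next
          case F: False
          then show ?thesis using staircase_mono(2)[OF \<rho>, of "m - 1" "l - t"] by simp
        qed
      qed simp
      then show ?thesis by (rule is_minimum_unique[OF Q])
    qed
    then have "Q = (\<lambda>l. \<rho> (l - t))" by blast
    then show ?thesis using staircase_shift[OF \<rho>, of "t"] by auto
  next
    case True
    then obtain i where i: "\<tau> (i + 1) < \<tau> i" by blast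
    \<comment> \<open>For \<open>k = 1\<close> periodicity gives
      \<open>\<tau> (i + 1) = \<tau> i + 1\<close>, so there is no descent.\<close>
    have k2: "2 \<le> k"
    proof (rule ccontr)
      assume "\<not> ?thesis"
      then have "k = 1" using k by simp
      then show False using per i unfolding periodic_def by force
    qed
    define s where "s = affine_swap k i"
    let ?t = "\<tau> \<circ> s"
    have ss: "s (s x) = x" for x using affine_swap_involution[OF k2] s_def by simp
    then have "bij s" by (metis bij_betw_byWitness[of UNIV s s UNIV] subset_UNIV)
    then have bij: "bij ?t" using less.prems(1) bij_comp by blast
    have sper: "periodic k s" using affine_swap_periodic[OF k2] s_def by simp
    have tper: "periodic k ?t" using per sper unfolding periodic_def by simp
    let ?W = "inversion_window k \<tau> i" and ?W' = "inversion_window k ?t i"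
    note W = inversion_window_affine_swap[OF per k2 i, folded s_def]
    have W1: "finite ?W" "card ?W = n" using less.prems(3) inv_k_eq_card_window[OF per k, of i]
      by (auto split: if_splits)
    then have finim: "finite ((\<lambda>(a, b). (s a, s b)) ` ?W')" unfolding W(1) by simp
    then have "finite ?W'" using W(3) finite_imageD by blast
    moreover have "n = Suc (card ?W')"
      using W1(2) unfolding W(1) using finim W(2) card_image[OF W(3)] by simp
    ultimately obtain n' where n': "n = Suc n'" "inv_k k ?t = enat n'"
      using inv_k_eq_card_window[OF tper k, of i] by simp
    have dnn: "0 \<le> \<rho> (m - 1) + dominance ?t (- m) (- l)" for m l
      using staircase_ge[OF \<rho>, of "m - 1"] unfolding dominance_def by simp
    define Q' where "Q' l = (SOME q. is_minimum (\<lambda>m. \<rho> (m - 1) + dominance ?t (- m) (- l)) q)" for l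
    have Q': "is_minimum (\<lambda>m. \<rho> (m - 1) + dominance ?t (- m) (- l)) (Q' l)" for l
      unfolding Q'_def by (rule someI_ex, rule is_minimum_exists) (rule dnn)
    have "excess c \<rho> + int n' < k" "n' < n" using less.prems(4) n' by auto
    then obtain c' where c': "staircase c' Q'" "excess c' Q' \<le> excess c \<rho> + int n'"
      using less.IH[OF _ bij tper n'(2) _ Q'] by blast
    \<comment> \<open>Rows are indexed by \<open>b = - l\<close>, so the exceptional residue
      \<open>i + 1\<close> of \<open>b\<close> becomes \<open>- i - 1\<close> for
      \<open>l\<close>.\<close>
    have offd: "dominance ?t a (- l) = dominance \<tau> a (- l)" if "\<not> k dvd l - (- i - 1)" for a l
    proof -
      have "- l - i - 1 = - (l - (- i - 1))" by simp
      then have "\<not> k dvd - l - i - 1" using that by (metis dvd_minus_iff)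
      then show ?thesis unfolding s_def by (rule dominance_affine_swap[OF k2])
    qed
    have off: "Q l = Q' l" if "\<not> k dvd l - (- i - 1)" for l
      by (rule is_minimum_unique[OF Q[of l] Q'[of l, unfolded offd[OF that]]])
    have on: "Q l = min (Q' (l + 1)) (Q' (l - 1) + 1)" if d: "k dvd l - (- i - 1)" for l
    proof -
      have nd: "\<not> k dvd (l + e) - (- i - 1)" if "e = 1 \<or> e = - 1" for e
      proof
        assume "k dvd (l + e) - (- i - 1)"
        then have "k dvd ((l + e) - (- i - 1)) - (l - (- i - 1))" using d dvd_diff by blast
        then have "k dvd 1" using that by auto
        then show False using k2 zdvd_not_zless[of 1 k] by auto
      qed
      have QQ: "Q (l + 1) = Q' (l + 1)" "Q (l - 1) = Q' (l - 1)"
        using off nd[of 1] off nd[of "-1"] by auto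
      have desc: "\<tau> (- l) < \<tau> (- l - 1)"
      proof -
        obtain j where "l - (- i - 1) = k * j" using d by (rule dvdE)
        then have "- l = (i + 1) + (- j) * k" "- l - 1 = i + (- j) * k" by (auto simp: algebra_simps)
        then have "\<tau> (- l) = \<tau> (i + 1) + (- j) * k" "\<tau> (- l - 1) = \<tau> i + (- j) * k"
          by (metis periodic_mult[OF per])+
        then show ?thesis using i by simp
      qed
      \<comment> \<open>With \<open>b = - l\<close>, this could fail only if
        \<open>\<tau> (b - 1) \<le> a < \<tau> b\<close>, which the descent \<open>desc\<close>
        rules out.\<close>
      have dm: "dominance \<tau> a (- l) = min (dominance \<tau> a (- (l + 1))) (dominance \<tau> a (- (l - 1)) + 1)" for a
      proof -
        have e: "- (l + 1) = - l - 1" "- (l - 1) = - l + 1" "- l - 1 + 1 = - l" by simp_all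
        show ?thesis unfolding e
          using desc dominance_step[OF per k, of a "- l"] dominance_step[OF per k, of a "- l - 1", unfolded e]
          by (auto simp: min_def)
      qed
      \<comment> \<open>The minimum over \<open>m\<close> commutes with the binary one, and at
        \<open>l + 1\<close> and \<open>l - 1\<close> the functions \<open>Q\<close> and
        \<open>Q'\<close> agree.\<close>
      have "is_minimum (\<lambda>m. min (\<rho> (m - 1) + dominance \<tau> (- m) (- (l + 1)))
          (\<rho> (m - 1) + dominance \<tau> (- m) (- (l - 1)) + 1)) (min (Q (l + 1)) (Q (l - 1) + 1))"
        by (rule is_minimum_min) (rule Q)+
      also have "(\<lambda>m. min (\<rho> (m - 1) + dominance \<tau> (- m) (- (l + 1)))
          (\<rho> (m - 1) + dominance \<tau> (- m) (- (l - 1)) + 1)) = (\<lambda>m. \<rho> (m - 1) + dominance \<tau> (- m) (- l))"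
        unfolding dm by (auto simp: min_def)
      finally show ?thesis unfolding QQ by (rule is_minimum_unique[OF Q[of l]])
    qed
    have small: "excess c' Q' < k - 1" using c'(2) less.prems(4) n' by simp
    note push = staircase_affine_push[where Q = Q and i = "- i - 1", OF c'(1) k2 small on off]
    show ?thesis using push c'(2) n'(1) by (intro exI[of _ c']) simp
  qed
qed

section \<open>Thresholds, and the size of a partition by rows and by diagonals\<close>

lemma int_threshold:
  fixes P :: "int \<Rightarrow> bool"
  assumes "mono P" and "\<not> P L" "P U"
  shows "\<exists>t. \<forall>a. P a \<longleftrightarrow> t \<le> a"
proof -
  have up: "P b" if "P a" "a \<le> b" for a b using monoD[OF assms(1) that(2)] that(1) by simp
  define n where "n = (LEAST n. P (L + int n))"
  have "L \<le> U" using up[of U L] assms(2,3) by linarith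
  then have "P (L + int (nat (U - L)))" using assms(3) by simp
  then have n: "P (L + int n)" unfolding n_def by (rule LeastI)
  have "P a \<longleftrightarrow> L + int n \<le> a" for a
  proof
    assume a: "P a"
    have "L < a" using up[OF a, of L] assms(2) by linarith
    then have "P (L + int (nat (a - L)))" using a by simp
    then have "n \<le> nat (a - L)" unfolding n_def by (rule Least_le)
    then show "L + int n \<le> a" using \<open>L < a\<close> by linarith
  qed (rule up[OF n])
  then show ?thesis by blast
qed

text \<open>A \<open>LEAST\<close> over the integers needs a lower bound, which the vanishing of
  \<open>\<rho>\<close> far to the left provides.\<close>

lemma staircase_threshold:
  assumes \<rho>: "staircase c \<rho>"
  shows "int i < \<rho> m \<longleftrightarrow> (LEAST l. int i < \<rho> l) \<le> m"
proof -
  obtain L U where L: "\<forall>m\<le>L. \<rho> m = 0" and U: "\<forall>m\<ge>U. \<rho> m = m - c + 1"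
    using \<rho> unfolding staircase_def by blast
  have up: "mono (\<lambda>a. int i < \<rho> a)"
    by (intro monoI le_boolI) (use staircase_mono(1)[OF \<rho>] less_le_trans in blast)
  have 1: "\<not> int i < \<rho> L" using L by simp
  have 2: "int i < \<rho> (max U (c + int i))" using U by simp
  obtain t where t: "\<And>a. int i < \<rho> a \<longleftrightarrow> t \<le> a"
    using int_threshold[of "\<lambda>a. int i < \<rho> a", OF up 1 2] by blast
  then have "(LEAST l. int i < \<rho> l) = t" by (intro Least_equality) auto
  then show ?thesis using t by simp
qed

text \<open>Double counting of the boxes of the Young diagram: row \<open>i\<close> meets the
  diagonals from \<open>s i\<close> up to \<open>c + i - 1\<close>, and diagonal \<open>m\<close>
  meets the rows from \<open>max 0 (m - c + 1)\<close> up to \<open>\<rho> m - 1\<close>.\<close>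

lemma sum_partition_eq_excess:
  fixes s :: "nat \<Rightarrow> int"
  assumes \<rho>: "staircase c \<rho>" and s: "\<And>i m. int i < \<rho> m \<longleftrightarrow> s i \<le> m"
  shows "finite {i. int i - s i + c \<noteq> 0}"
    and "(\<Sum>i\<in>{i. int i - s i + c \<noteq> 0}. int i - s i + c) = excess c \<rho>"
proof -
  let ?I = "{i. int i - s i + c \<noteq> 0}" and ?M = "{m. \<rho> m \<noteq> max 0 (m - c + 1)}"
  have nn: "s i \<le> c + int i" for i
    using s[of i "c + int i"] staircase_ge[OF \<rho>, of "c + int i"] by simp
  \<comment> \<open>Boxes in coordinates (row, diagonal).\<close>
  define X where "X = {(i, m). s i \<le> m \<and> m < c + int i}"
  have XI: "X = (SIGMA i:?I. {s i..<c + int i})" unfolding X_def by auto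
  have XM: "prod.swap ` X = (SIGMA m:?M. {nat (max 0 (m - c + 1))..<nat (\<rho> m)})" (is "_ = ?Y")
  proof -
    have "(i, m) \<in> X \<longleftrightarrow> (m, i) \<in> ?Y" for i m
      unfolding X_def using s[of i m, symmetric] by auto
    then have "p \<in> prod.swap ` X \<longleftrightarrow> p \<in> ?Y" for p
      by (cases p) (simp only: pair_in_swap_image)
    then show ?thesis by blast
  qed
  have finY: "finite ?Y" using staircase_finite_excess[OF \<rho>] by simp
  then have finX: "finite X" using XM by (metis finite_imageD inj_swap)
  have "?I \<subseteq> fst ` X"
  proof
    fix i assume "i \<in> ?I"
    then have "(i, s i) \<in> X" unfolding X_def using nn[of i] by auto
    then show "i \<in> fst ` X" by force
  qed
  then show finI: "finite ?I" using finX by (meson finite_imageI finite_subset)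
  have "(\<Sum>i\<in>?I. int i - s i + c) = int (\<Sum>i\<in>?I. card {s i..<c + int i})"
    unfolding of_nat_sum using nn by (intro sum.cong) (auto simp: algebra_simps)
  also have "\<dots> = int (card X)" unfolding XI using finI by simp
  also have "card X = card ?Y" using XM by (metis card_image inj_swap)
  also have "int (card ?Y) = (\<Sum>m\<in>?M. int (card {nat (max 0 (m - c + 1))..<nat (\<rho> m)}))"
    using staircase_finite_excess[OF \<rho>] by simp
  also have "\<dots> = excess c \<rho>" unfolding excess_def
  proof (intro sum.cong refl)
    fix m
    show "int (card {nat (max 0 (m - c + 1))..<nat (\<rho> m)}) = \<rho> m - max 0 (m - c + 1)"
      using staircase_ge[OF \<rho>, of m] unfolding card_atLeastLessThan by linarith
  qed
  finally show "(\<Sum>i\<in>?I. int i - s i + c) = excess c \<rho>" .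
qed

subsection \<open>Weierstrass partitions\<close>

lemma deg_add_mult_pt:
  assumes "is_graph G" "v \<in> verts G"
  shows "deg G (\<lambda>x. D x + m * pt v x) = deg G D + m"
  using assms unfolding is_graph_def by (simp add: deg_add deg_mult_pt)

text \<open>Adding 1 to the rank turns the value -1 in negative degree into the 0 of the left end;
  the right end starts at degree 2g - 1.\<close>

lemma staircase_rank:
  assumes G: "is_graph G" and v: "v \<in> verts G"
  shows "staircase (genus G - deg G D) (\<lambda>m. rank G (\<lambda>x. D x + m * pt v x) + 1)"
  unfolding staircase_def
proof (intro conjI allI exI impI)
  fix m
  have e: "(\<lambda>x. D x + (m + 1) * pt v x) = (\<lambda>x. (D x + m * pt v x) + pt v x)"
    by (auto simp: algebra_simps)
  show "rank G (\<lambda>x. D x + m * pt v x) + 1 \<le> rank G (\<lambda>x. D x + (m + 1) * pt v x) + 1"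
    "rank G (\<lambda>x. D x + (m + 1) * pt v x) + 1 \<le> rank G (\<lambda>x. D x + m * pt v x) + 1 + 1"
    unfolding e using rank_add_pt[OF G v, of "\<lambda>x. D x + m * pt v x"] by auto
next
  fix m assume "m \<le> - deg G D - 1"
  then show "rank G (\<lambda>x. D x + m * pt v x) + 1 = 0"
    using rank_eq_minus_one_if_deg_neg[OF G] deg_add_mult_pt[OF G v, of D m] by simp
next
  fix m assume "m \<ge> 2 * genus G - 1 - deg G D"
  then show "rank G (\<lambda>x. D x + m * pt v x) + 1 = m - (genus G - deg G D) + 1"
    using rank_eq_deg_minus_genus[OF G, of "\<lambda>x. D x + m * pt v x"] deg_add_mult_pt[OF G v, of D m] by simp
qed

lemma weierstrass_size_eq_excess:
  assumes "is_graph G" "v \<in> verts G"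
  shows "finite {i. lambda_idx G D v i \<noteq> 0}"
    and "weierstrass_size G D v
      = excess (genus G - deg G D) (\<lambda>m. rank G (\<lambda>x. D x + m * pt v x) + 1)"
proof -
  let ?r = "\<lambda>m. rank G (\<lambda>x. D x + m * pt v x) + 1"
  note st = staircase_rank[OF assms, of D]
  have s: "int i < ?r m \<longleftrightarrow> s_idx G D v i \<le> m" for i m
    unfolding s_idx_def using staircase_threshold[OF st, of i m] by simp
  have l: "lambda_idx G D v i = int i - s_idx G D v i + (genus G - deg G D)" for i
    unfolding lambda_idx_def by simp
  show "finite {i. lambda_idx G D v i \<noteq> 0}" "weierstrass_size G D v = excess (genus G - deg G D) ?r"
    unfolding weierstrass_size_def l using sum_partition_eq_excess[OF st s] by auto
qed

lemma BN_general_iff: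
  assumes "is_graph G" "v \<in> verts G"
  shows "BN_general G v \<longleftrightarrow> (\<forall>D. is_divisor G D \<longrightarrow>
    excess (genus G - deg G D) (\<lambda>m. rank G (\<lambda>x. D x + m * pt v x) + 1) \<le> genus G)"
  unfolding BN_general_def using weierstrass_size_eq_excess[OF assms] by simp

subsection \<open>The transmission permutation\<close>

text \<open>The difference of \<open>R\<close> in \<open>b\<close> is 0 or 1, and
  \<open>0 \<le> d\<close> makes it monotone in \<open>a\<close>, so it jumps at one place
  \<open>\<tau> b\<close>; the difference in \<open>a\<close> likewise jumps at
  \<open>\<sigma> a\<close>. Since \<open>d\<close> is the difference of either one, it marks the
  graphs of both, which makes them inverse up to the offset 1 from comparing \<open>b\<close> with
  \<open>b + 1\<close>.\<close>

lemma submodular_permutation: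
  fixes R :: "int \<Rightarrow> int \<Rightarrow> int"
  defines "d \<equiv> \<lambda>a b. R a b - R (a - 1) b - R a (b + 1) + R (a - 1) (b + 1)"
  assumes s1: "\<And>a b. R (a - 1) b \<le> R a b \<and> R a b \<le> R (a - 1) b + 1"
    and s2: "\<And>a b. R a (b + 1) \<le> R a b \<and> R a b \<le> R a (b + 1) + 1"
    and sub: "\<And>a b. 0 \<le> d a b"
    and low: "\<And>a b. a - b \<le> L \<Longrightarrow> R a b = 0"
    and high: "\<And>a b. U \<le> a - b \<Longrightarrow> R a b = a - b + e"
  obtains \<tau> where "bij \<tau>" "\<And>a b. (if \<tau> b = a then 1 else 0) = d a b"
    "\<And>a b. R a b = R a (b + 1) + (if \<tau> b \<le> a then 1 else 0)"
proof -
  have "\<exists>t. \<forall>a. 1 \<le> R a b - R a (b + 1) \<longleftrightarrow> t \<le> a" for b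
  proof -
    let ?P = "\<lambda>a. 1 \<le> R a b - R a (b + 1)"
    have "?P a'" if "a \<le> a'" "?P a" for a a'
      using that
    proof (induction rule: int_ge_induct)
      case (step i) then show ?case using sub[of "i + 1" b] unfolding d_def by simp
    qed
    then have up: "mono ?P" by (intro monoI le_boolI)
    have "\<not> ?P (b + L)" using low[of "b + L" b] low[of "b + L" "b + 1"] by simp
    moreover have "?P (b + 1 + U)" using high[of "b + 1 + U" b] high[of "b + 1 + U" "b + 1"] by simp
    ultimately show ?thesis using int_threshold[of ?P, OF up] by blast
  qed
  then obtain \<tau> where "\<And>a b. 1 \<le> R a b - R a (b + 1) \<longleftrightarrow> \<tau> b \<le> a" by metis
  then have \<tau>: "R a b = R a (b + 1) + (if \<tau> b \<le> a then 1 else 0)" for a b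
    using s2[of a b] by (smt (verit))
  have d\<tau>: "d a b = (if \<tau> b = a then 1 else 0)" for a b
    unfolding d_def using \<tau>[of a b] \<tau>[of "a - 1" b] by auto
  have "\<exists>t. \<forall>b. R a b - R (a - 1) b \<le> 0 \<longleftrightarrow> t \<le> b" for a
  proof -
    let ?P = "\<lambda>b. R a b - R (a - 1) b \<le> 0"
    have "?P b'" if "b \<le> b'" "?P b" for b b'
      using that
    proof (induction rule: int_ge_induct)
      case (step i) then show ?case using sub[of a i] unfolding d_def by simp
    qed
    then have up: "mono ?P" by (intro monoI le_boolI)
    have "?P (a - L)" using low[of a "a - L"] low[of "a - 1" "a - L"] by simp
    moreover have "\<not> ?P (a - 1 - U)" using high[of a "a - 1 - U"] high[of "a - 1" "a - 1 - U"] by simp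
    ultimately show ?thesis using int_threshold[of ?P, OF up] by blast
  qed
  then obtain \<sigma> where "\<And>a b. R a b - R (a - 1) b \<le> 0 \<longleftrightarrow> \<sigma> a \<le> b" by metis
  then have \<sigma>: "R a b = R (a - 1) b + (if \<sigma> a \<le> b then 0 else 1)" for a b
    using s1[of a b] by (smt (verit))
  have "d a b = (if b = \<sigma> a - 1 then 1 else 0)" for a b
    unfolding d_def using \<sigma>[of a b] \<sigma>[of a "b + 1"] by auto
  then have eq: "\<tau> b = a \<longleftrightarrow> b = \<sigma> a - 1" for a b using d\<tau>[of a b] by (metis zero_neq_one)
  have "bij \<tau>"
    by (rule bij_betw_byWitness[where f' = "\<lambda>a. \<sigma> a - 1"]) (auto simp: eq eq[THEN iffD1, OF refl, symmetric])
  then show ?thesis using d\<tau>[symmetric] \<tau> by (rule that)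
qed

lemma transmission_props:
  fixes k :: nat
  assumes G: "is_graph G" and u: "u \<in> verts G" and v: "v \<in> verts G"
    and sub: "submodular G u v D"
    and lin: "lin_equiv G (\<lambda>x. int k * pt u x) (\<lambda>x. int k * pt v x)" and k: "0 < k"
  shows "bij (transmission G u v D)" "periodic (int k) (transmission G u v D)"
    "rank G (twist u v D a (- b)) + 1 = dominance (transmission G u v D) a b"
proof -
  define R where "R a b = rank G (twist u v D a (- b)) + 1" for a b
  let ?d = "\<lambda>a b. R a b - R (a - 1) b - R a (b + 1) + R (a - 1) (b + 1)"
  have tu: "twist u v D a b = (\<lambda>x. twist u v D (a - 1) b x + pt u x)" for a b
    unfolding twist_def by (auto simp: algebra_simps)
  have tv: "twist u v D a (- b) = (\<lambda>x. twist u v D a (- (b + 1)) x + pt v x)" for a b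
    unfolding twist_def by (auto simp: algebra_simps)
  have s1: "R (a - 1) b \<le> R a b \<and> R a b \<le> R (a - 1) b + 1" for a b
    unfolding R_def tu[of a] using rank_add_pt[OF G u, of "twist u v D (a - 1) (- b)"] by simp
  have s2: "R a (b + 1) \<le> R a b \<and> R a b \<le> R a (b + 1) + 1" for a b
    unfolding R_def tv[of a b] using rank_add_pt[OF G v, of "twist u v D a (- (b + 1))"] by simp
  have delta: "?d a b = Delta G u v (twist u v D a (- b))" for a b
  proof -
    have "(\<lambda>x. twist u v D a (- b) x - pt u x) = twist u v D (a - 1) (- b)"
      "(\<lambda>x. twist u v D a (- b) x - pt v x) = twist u v D a (- (b + 1))"
      "(\<lambda>x. twist u v D a (- b) x - pt u x - pt v x) = twist u v D (a - 1) (- (b + 1))"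
      unfolding twist_def by (auto simp: algebra_simps)
    then show ?thesis unfolding Delta_def R_def by simp
  qed
  have nn: "0 \<le> ?d a b" for a b using sub unfolding delta submodular_def by blast
  have dg: "deg G (twist u v D a b) = deg G D + a + b" for a b
    unfolding twist_def using deg_add_mult_pt[OF G v] deg_add_mult_pt[OF G u] by simp
  have low: "R a b = 0" if "a - b \<le> - deg G D - 1" for a b
    unfolding R_def using rank_eq_minus_one_if_deg_neg[OF G, of "twist u v D a (- b)"] that by (simp add: dg)
  have high: "R a b = a - b + (deg G D - genus G + 1)" if "2 * genus G - 1 - deg G D \<le> a - b" for a b
    unfolding R_def using rank_eq_deg_minus_genus[OF G, of "twist u v D a (- b)"] that by (simp add: dg)
  obtain \<tau> where bij: "bij \<tau>" and d: "\<And>a b. (if \<tau> b = a then 1 else 0) = ?d a b"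
    and st: "\<And>a b. R a b = R a (b + 1) + (if \<tau> b \<le> a then 1 else 0)"
    using submodular_permutation[of R, OF s1 s2 nn low high] by blast
  have \<tau>: "transmission G u v D = \<tau>"
    unfolding transmission_def
  proof (rule the_equality)
    show "bij \<tau> \<and> (\<forall>a b. (if \<tau> b = a then 1 else 0) = Delta G u v (twist u v D a (- b)))"
      using bij d unfolding delta by blast
    fix \<tau>' assume "bij \<tau>' \<and> (\<forall>a b. (if \<tau>' b = a then 1 else 0) = Delta G u v (twist u v D a (- b)))"
    then have "(if \<tau>' b = a then 1 else 0) = (if \<tau> b = a then 1 else 0 :: int)" for a b
      unfolding d delta by simp
    then show "\<tau>' = \<tau>" by (intro ext) (metis zero_neq_one)
  qed
  obtain f where f: "\<forall>x\<in>verts G. int k * pt v x = int k * pt u x + firing G f x"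
    using lin unfolding lin_equiv_iff_firing by blast
  \<comment> \<open>Adding \<open>k u\<close> and removing \<open>k v\<close> does not change the
    divisor class.\<close>
  have per: "R (a + int k) (b + int k) = R a b" for a b
  proof -
    have "rank G (twist u v D a (- b)) = rank G (twist u v D (a + int k) (- (b + int k)))"
      by (rule rank_firing[where f = f]) (use f in \<open>auto simp: twist_def algebra_simps\<close>)
    then show ?thesis unfolding R_def by simp
  qed
  have "\<tau> (x + int k) = \<tau> x + int k" for x
  proof -
    have "?d (\<tau> x + int k) (x + int k) = ?d (\<tau> x) x"
      using per[of "\<tau> x" x] per[of "\<tau> x - 1" x] per[of "\<tau> x" "x + 1"] per[of "\<tau> x - 1" "x + 1"]
      by (simp add: algebra_simps)
    then show ?thesis using d[where a = "\<tau> x" and b = x] d[where a = "\<tau> x + int k" and b = "x + int k"]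
      by (metis zero_neq_one)
  qed
  then have pk: "periodic (int k) \<tau>" unfolding periodic_def by blast
  have "R a b = dominance \<tau> a b"
  proof -
    \<comment> \<open>From \<open>B\<close> on the degree is negative, so \<open>R\<close> and the
      dot count both vanish; below \<open>B\<close> they obey the same recursion in
      \<open>b\<close>.\<close>
    define B where "B = a + deg G D + 1"
    have R0: "R a j = 0" if "B \<le> j" for j using low[of a j] that B_def by simp
    have "\<not> \<tau> j \<le> a" if "B \<le> j" for j
      using st[of a j] R0[of j] R0[of "j + 1"] that by (auto split: if_splits)
    then have D0: "dominance \<tau> a j = 0" if "B \<le> j" for j
      unfolding dominance_def using that by (auto intro!: arg_cong[where f = card, of _ "{}", simplified])
    show ?thesis
    proof (cases "B \<le> b")
      case True then show ?thesis using R0 D0 by simp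
    next
      case False
      then have "b \<le> B" by simp
      then show ?thesis
      proof (induction rule: int_le_induct)
        case base then show ?case using R0 D0 by simp
      next
        case (step i)
        then show ?case using st[of a "i - 1"] dominance_step[OF pk, of a "i - 1"] k by simp
      qed
    qed
  qed
  then show "bij (transmission G u v D)" "periodic (int k) (transmission G u v D)"
    "rank G (twist u v D a (- b)) + 1 = dominance (transmission G u v D) a b"
    unfolding \<tau> using bij pk R_def by auto
qed

subsection \<open>Vertex gluing\<close>

locale vertex_gluing =
  fixes G1 :: "'a mgraph" and v1 :: 'a and G2 :: "'b mgraph" and u2 :: 'b
  assumes G1: "is_graph G1" and v1: "v1 \<in> verts G1"
    and G2: "is_graph G2" and u2: "u2 \<in> verts G2"
begin

abbreviation glued :: "('a + 'b) mgraph" where "glued \<equiv> vertex_glue G1 v1 G2 u2"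

abbreviation glue :: "'b \<Rightarrow> 'a + 'b" where "glue \<equiv> glue_map v1 u2"

lemma finite_verts: "finite (verts G1)" "finite (verts G2)"
  using G1 G2 unfolding is_graph_def by auto

lemma verts_glued: "verts glued = Inl ` verts G1 \<union> Inr ` (verts G2 - {u2})"
  unfolding vertex_glue_def by simp

lemma finite_glued: "finite (verts glued)"
  unfolding verts_glued using finite_verts by simp

lemma glue_in_verts: "y \<in> verts G2 \<Longrightarrow> glue y \<in> verts glued"
  unfolding verts_glued glue_map_def using v1 by auto

lemma glue_fibre:
  "{y \<in> verts G2. glue y = Inl x} = (if x = v1 then {u2} else {})"
  "y \<in> verts G2 - {u2} \<Longrightarrow> {y' \<in> verts G2. glue y' = Inr y} = {y}"
  unfolding glue_map_def using u2 by auto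

lemma glue_inj: "glue y = glue y' \<Longrightarrow> y = y'"
  unfolding glue_map_def by (auto split: if_splits)

lemma sum_verts_glued:
  fixes h :: "'a + 'b \<Rightarrow> 'c :: comm_monoid_add"
  shows "(\<Sum>p\<in>verts glued. h p) = (\<Sum>x\<in>verts G1. h (Inl x)) + (\<Sum>y\<in>verts G2 - {u2}. h (Inr y))"
proof -
  have "(\<Sum>p\<in>verts glued. h p) = sum h (Inl ` verts G1) + sum h (Inr ` (verts G2 - {u2}))"
    unfolding verts_glued by (rule sum.union_disjoint) (use finite_verts in auto)
  then show ?thesis by (simp add: sum.reindex)
qed

lemma mult_glued:
  "mult glued p q = (case (p, q) of (Inl a, Inl a') \<Rightarrow> mult G1 a a' | _ \<Rightarrow> 0)
     + (\<Sum>y\<in>{y\<in>verts G2. glue y = p}. \<Sum>y'\<in>{y'\<in>verts G2. glue y' = q}. mult G2 y y')"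
  unfolding vertex_glue_def by simp

text \<open>Regrouping the fibres of \<open>glue\<close> turns the second summand of
  \<open>mult\<close> into a sum over \<open>verts G2\<close>. The weight \<open>h\<close> is
  general so that this serves both firing and counting edges.\<close>

lemma sum_mult_glued:
  fixes h :: "'a + 'b \<Rightarrow> int"
  shows "(\<Sum>q\<in>verts glued. int (mult glued p q) * h q) =
    (case p of Inl a \<Rightarrow> \<Sum>a'\<in>verts G1. int (mult G1 a a') * h (Inl a') | Inr _ \<Rightarrow> 0)
    + (\<Sum>y\<in>{y\<in>verts G2. glue y = p}. \<Sum>y'\<in>verts G2. int (mult G2 y y') * h (glue y'))"
proof -
  let ?Y = "\<lambda>q. {y\<in>verts G2. glue y = q}"
  have "(\<Sum>q\<in>verts glued. int (mult glued p q) * h q) =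
    (\<Sum>q\<in>verts glued. int (case (p, q) of (Inl a, Inl a') \<Rightarrow> mult G1 a a' | _ \<Rightarrow> 0) * h q)
    + (\<Sum>q\<in>verts glued. \<Sum>y\<in>?Y p. \<Sum>y'\<in>?Y q. int (mult G2 y y') * h (glue y'))"
    unfolding mult_glued sum.distrib[symmetric]
    by (intro sum.cong refl) (simp add: distrib_right sum_distrib_right)
  also have "(\<Sum>q\<in>verts glued. int (case (p, q) of (Inl a, Inl a') \<Rightarrow> mult G1 a a' | _ \<Rightarrow> 0) * h q)
    = (case p of Inl a \<Rightarrow> \<Sum>a'\<in>verts G1. int (mult G1 a a') * h (Inl a') | Inr _ \<Rightarrow> 0)"
    unfolding sum_verts_glued by (cases p) auto
  also have "(\<Sum>q\<in>verts glued. \<Sum>y\<in>?Y p. \<Sum>y'\<in>?Y q. int (mult G2 y y') * h (glue y'))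
    = (\<Sum>y\<in>?Y p. \<Sum>q\<in>verts glued. \<Sum>y'\<in>?Y q. int (mult G2 y y') * h (glue y'))"
    by (rule sum.swap)
  also have "\<dots> = (\<Sum>y\<in>?Y p. \<Sum>y'\<in>verts G2. int (mult G2 y y') * h (glue y'))"
    by (intro sum.cong refl sum.group finite_verts finite_glued) (use glue_in_verts in auto)
  finally show ?thesis .
qed

lemma firing_glued:
  "firing glued f (Inl x) = firing G1 (\<lambda>x. f (Inl x)) x
     + (if x = v1 then firing G2 (\<lambda>y. f (glue y)) u2 else 0)"
  "y \<in> verts G2 - {u2} \<Longrightarrow> firing glued f (Inr y) = firing G2 (\<lambda>y. f (glue y)) y"
proof -
  have "glue u2 = Inl v1" by (simp add: glue_map_def)
  then show "firing glued f (Inl x) = firing G1 (\<lambda>x. f (Inl x)) x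
     + (if x = v1 then firing G2 (\<lambda>y. f (glue y)) u2 else 0)"
    unfolding firing_def sum_mult_glued glue_fibre(1) by simp
  assume y: "y \<in> verts G2 - {u2}"
  then have "glue y = Inr y" by (simp add: glue_map_def)
  then show "firing glued f (Inr y) = firing G2 (\<lambda>y. f (glue y)) y"
    unfolding firing_def sum_mult_glued glue_fibre(2)[OF y] by simp
qed

lemma is_graph_glued: "is_graph glued"
  unfolding is_graph_def
proof (intro conjI allI impI ballI)
  have sym1: "mult G1 x y = mult G1 y x" and irr1: "mult G1 x x = 0"
    and sup1: "mult G1 x y > 0 \<Longrightarrow> x \<in> verts G1" for x y
    using G1 unfolding is_graph_def by blast+
  have sym2: "mult G2 x y = mult G2 y x" and irr2: "mult G2 x x = 0" for x y
    using G2 unfolding is_graph_def by blast+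
  show "finite (verts glued)" by (rule finite_glued)
  show "verts glued \<noteq> {}" using v1 unfolding verts_glued by blast
  show sym: "mult glued p q = mult glued q p" for p q
  proof -
    have "(\<Sum>y\<in>{y\<in>verts G2. glue y = p}. \<Sum>y'\<in>{y'\<in>verts G2. glue y' = q}. mult G2 y y')
      = (\<Sum>y'\<in>{y'\<in>verts G2. glue y' = q}. \<Sum>y\<in>{y\<in>verts G2. glue y = p}. mult G2 y' y)"
      by (subst sum.swap, intro sum.cong refl) (rule sym2)
    then show ?thesis unfolding mult_glued by (auto split: sum.splits intro: sym1)
  qed
  show "mult glued p p = 0" for p
  proof -
    have "mult G2 y y' = 0" if "glue y = p" "glue y' = p" for y y'
      using that glue_inj irr2 by metis
    then show ?thesis unfolding mult_glued by (auto split: sum.splits simp: irr1)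
  qed
  have sup: "p \<in> verts glued" if "mult glued p q > 0" for p q
  proof (cases "{y\<in>verts G2. glue y = p} = {}")
    case True
    have "(case (p, q) of (Inl a, Inl a') \<Rightarrow> mult G1 a a' | _ \<Rightarrow> 0) > 0"
      using that unfolding mult_glued True by simp
    then show ?thesis using sup1 unfolding verts_glued by (auto split: sum.splits)
  next
    case False then show ?thesis using glue_in_verts by blast
  qed
  show "p \<in> verts glued" "q \<in> verts glued" if "mult glued p q > 0" for p q
    using sup that sym by metis+
  let ?R = "\<lambda>a b. mult glued a b > 0"
  have c1: "?R\<^sup>*\<^sup>* (Inl x) (Inl y)" if "x \<in> verts G1" "y \<in> verts G1" for x y
  proof -
    have "(\<lambda>a b. mult G1 a b > 0)\<^sup>*\<^sup>* x y" using G1 that unfolding is_graph_def by blast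
    then show ?thesis
    proof induction
      case (step y z)
      have "?R (Inl y) (Inl z)" unfolding mult_glued using step(2) by simp
      with step(3) show ?case by (rule rtranclp.rtrancl_into_rtrancl)
    qed simp
  qed
  have c2: "?R\<^sup>*\<^sup>* (glue x) (glue y)" if "x \<in> verts G2" "y \<in> verts G2" for x y
  proof -
    have "(\<lambda>a b. mult G2 a b > 0)\<^sup>*\<^sup>* x y" using G2 that unfolding is_graph_def by blast
    then show ?thesis
    proof induction
      case (step y z)
      have yz: "y \<in> verts G2" "z \<in> verts G2" using step(2) G2 unfolding is_graph_def by blast+
      have "{w\<in>verts G2. glue w = glue y} = {y}" "{w\<in>verts G2. glue w = glue z} = {z}"
        using yz glue_inj by auto
      then have "?R (glue y) (glue z)" unfolding mult_glued using step(2) by simp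
      with step(3) show ?case by (rule rtranclp.rtrancl_into_rtrancl)
    qed simp
  qed
  have u: "glue u2 = Inl v1" by (simp add: glue_map_def)
  have "?R\<^sup>*\<^sup>* p (Inl v1) \<and> ?R\<^sup>*\<^sup>* (Inl v1) p" if "p \<in> verts glued" for p
  proof (cases p)
    case (Inl a) then show ?thesis using c1 v1 that unfolding verts_glued by auto
  next
    case (Inr y)
    then have "y \<in> verts G2" "p = glue y" using that unfolding verts_glued glue_map_def by auto
    then show ?thesis using c2[OF _ u2, of y] c2[OF u2, of y] u by simp
  qed
  then show "?R\<^sup>*\<^sup>* p q" if "p \<in> verts glued" "q \<in> verts glued" for p q
    using that rtranclp_trans by metis
qed

lemma genus_glued: "genus glued = genus G1 + genus G2"
proof -
  let ?F = "\<lambda>y. \<Sum>y'\<in>verts G2. int (mult G2 y y')"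
  have "edge_ends glued (verts glued) = (\<Sum>p\<in>verts glued.
      (case p of Inl a \<Rightarrow> \<Sum>a'\<in>verts G1. int (mult G1 a a') | Inr _ \<Rightarrow> 0))
      + (\<Sum>p\<in>verts glued. \<Sum>y\<in>{y\<in>verts G2. glue y = p}. ?F y)"
    unfolding edge_ends_def sum.distrib[symmetric]
    using sum_mult_glued[where h = "\<lambda>_. 1"] by (simp cong: sum.case_cong)
  also have "(\<Sum>p\<in>verts glued. \<Sum>y\<in>{y\<in>verts G2. glue y = p}. ?F y) = (\<Sum>y\<in>verts G2. ?F y)"
    by (rule sum.group) (use finite_verts finite_glued glue_in_verts in auto)
  finally have "edge_ends glued (verts glued) = edge_ends G1 (verts G1) + edge_ends G2 (verts G2)"
    unfolding sum_verts_glued by (simp add: edge_ends_def)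
  moreover have "card (verts glued) = card (verts G1) + card (verts G2 - {u2})"
    unfolding verts_glued using finite_verts
    by (subst card_Un_disjoint) (auto simp: card_image)
  moreover have "card (verts G2) = Suc (card (verts G2 - {u2}))"
    using finite_verts u2 by (metis card.remove)
  ultimately show ?thesis
    using two_genus[OF is_graph_glued] two_genus[OF G1] two_genus[OF G2] by simp
qed

text \<open>A divisor on \<open>glued\<close> is the sum of the two pushforwards; the chips at the gluing vertex may be
  distributed arbitrarily over both sides, so the decomposition is not unique.\<close>

definition decomposes :: "('a + 'b) divisor \<Rightarrow> 'a divisor \<Rightarrow> 'b divisor \<Rightarrow> bool" where
  "decomposes D D1 D2 \<longleftrightarrow>
     (\<forall>x\<in>verts G1. D (Inl x) = D1 x + (if x = v1 then D2 u2 else 0)) \<and>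
     (\<forall>y\<in>verts G2 - {u2}. D (Inr y) = D2 y)"

lemma decomposes_diff:
  "decomposes D D1 D2 \<Longrightarrow> decomposes E E1 E2 \<Longrightarrow>
    decomposes (\<lambda>x. D x - E x) (\<lambda>x. D1 x - E1 x) (\<lambda>x. D2 x - E2 x)"
  unfolding decomposes_def by auto

lemma deg_decomposes:
  assumes "decomposes D D1 D2" shows "deg glued D = deg G1 D1 + deg G2 D2"
proof -
  have "deg glued D = (\<Sum>x\<in>verts G1. D1 x + (if x = v1 then D2 u2 else 0)) + (\<Sum>y\<in>verts G2 - {u2}. D2 y)"
    unfolding deg_def sum_verts_glued using assms unfolding decomposes_def by simp
  moreover have "(\<Sum>y\<in>verts G2. D2 y) = D2 u2 + (\<Sum>y\<in>verts G2 - {u2}. D2 y)"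
    using finite_verts u2 by (simp add: sum.remove)
  ultimately show ?thesis unfolding deg_def using finite_verts v1 by (simp add: sum.distrib)
qed

text \<open>Here \<open>l\<close> is the number of chips passed from the second side to the first at
  the gluing vertex.\<close>

lemma winnable_glued_iff:
  assumes D: "decomposes D D1 D2"
  shows "winnable glued D \<longleftrightarrow> (\<exists>l. winnable G1 (\<lambda>x. D1 x + l * pt v1 x) \<and>
    winnable G2 (\<lambda>y. D2 y - l * pt u2 y))"
proof
  assume "winnable glued D"
  then obtain f where f: "\<forall>x\<in>verts glued. 0 \<le> D x + firing glued f x"
    unfolding winnable_iff_firing by blast
  let ?f2 = "\<lambda>y. f (glue y)"
  \<comment> \<open>Hand everything at the gluing vertex to the first side, leaving exactly 0 at
    \<open>u2\<close>.\<close>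
  define l where "l = D2 u2 + firing G2 ?f2 u2"
  have "winnable G1 (\<lambda>x. D1 x + l * pt v1 x)"
  proof (rule winnableI[where f = "\<lambda>x. f (Inl x)"])
    fix x assume x: "x \<in> verts G1"
    then have "0 \<le> D (Inl x) + firing glued f (Inl x)" using f verts_glued by blast
    then show "0 \<le> D1 x + l * pt v1 x + firing G1 (\<lambda>x. f (Inl x)) x"
      using D x unfolding firing_glued decomposes_def l_def pt_def by (auto split: if_splits)
  qed
  moreover have "winnable G2 (\<lambda>y. D2 y - l * pt u2 y)"
  proof (rule winnableI[where f = ?f2])
    fix y assume y: "y \<in> verts G2"
    show "0 \<le> D2 y - l * pt u2 y + firing G2 ?f2 y"
    proof (cases "y = u2")
      case True then show ?thesis unfolding l_def pt_def by simp
    next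
      case False
      then have y': "y \<in> verts G2 - {u2}" using y by simp
      then have "0 \<le> D (Inr y) + firing glued f (Inr y)" using f verts_glued by blast
      then show ?thesis using D y' False unfolding firing_glued(2)[OF y'] decomposes_def pt_def by simp
    qed
  qed
  ultimately show "\<exists>l. winnable G1 (\<lambda>x. D1 x + l * pt v1 x) \<and> winnable G2 (\<lambda>y. D2 y - l * pt u2 y)"
    by blast
next
  assume "\<exists>l. winnable G1 (\<lambda>x. D1 x + l * pt v1 x) \<and> winnable G2 (\<lambda>y. D2 y - l * pt u2 y)"
  then obtain l f1 f2 where f1: "\<forall>x\<in>verts G1. 0 \<le> D1 x + l * pt v1 x + firing G1 f1 x"
    and f2: "\<forall>y\<in>verts G2. 0 \<le> D2 y - l * pt u2 y + firing G2 f2 y"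
    unfolding winnable_iff_firing by blast
  \<comment> \<open>A constant does not affect firing, so the second script is shifted to agree with
    the first at the gluing vertex.\<close>
  define f where "f = case_sum f1 (\<lambda>y. f2 y + (f1 v1 - f2 u2))"
  have fg: "f (glue y) = f2 y + (f1 v1 - f2 u2)" for y unfolding f_def glue_map_def by simp
  have ff: "firing G2 (\<lambda>y. f (glue y)) y = firing G2 f2 y" for y unfolding fg by (rule firing_shift)
  have fl: "(\<lambda>x. f (Inl x)) = f1" unfolding f_def by simp
  show "winnable glued D"
  proof (rule winnableI[where f = f])
    fix p assume "p \<in> verts glued"
    then consider x where "p = Inl x" "x \<in> verts G1" | y where "p = Inr y" "y \<in> verts G2 - {u2}"
      unfolding verts_glued by blast
    then show "0 \<le> D p + firing glued f p"
    proof cases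
      case (1 x)
      show ?thesis
      proof (cases "x = v1")
        case True
        have "0 \<le> (D1 v1 + l + firing G1 f1 v1) + (D2 u2 - l + firing G2 f2 u2)"
          using f1[rule_format, OF v1] f2[rule_format, OF u2] by (simp add: pt_def)
        then show ?thesis using D v1
          unfolding decomposes_def 1(1) True firing_glued(1) ff fl by simp
      next
        case False
        then show ?thesis using D 1 f1[rule_format, of x]
          unfolding decomposes_def 1(1) firing_glued(1) ff fl by (simp add: pt_def)
      qed
    next
      case (2 y)
      then show ?thesis using D f2[rule_format, of y]
        unfolding decomposes_def 2(1) firing_glued(2)[OF 2(2)] ff by (simp add: pt_def)
    qed
  qed
qed

text \<open>An obstruction on the glued graph is a pair of obstructions, one at \<open>m - 1\<close>
  and one at \<open>m\<close>. The offset is what defeats every transfer \<open>l\<close>: either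
  \<open>l \<le> m - 1\<close> and the first side fails, or \<open>l \<ge> m\<close> and the second
  does. An obstruction needs at least rank + 1 chips, whence the two summands.\<close>

lemma rank_glued_less_iff:
  assumes D: "decomposes D D1 D2"
  shows "rank glued D < int r \<longleftrightarrow> (\<exists>m. (rank G1 (\<lambda>x. D1 x + (m - 1) * pt v1 x) + 1)
      + (rank G2 (\<lambda>y. D2 y - m * pt u2 y) + 1) \<le> int r)"
    (is "_ \<longleftrightarrow> (\<exists>m. ?r1 m + ?r2 m \<le> int r)")
proof
  assume "rank glued D < int r"
  then obtain E where E: "is_divisor glued E" "effective glued E" "deg glued E = int r"
    and nw: "\<not> winnable glued (\<lambda>x. D x - E x)" by (rule rank_lessE[OF is_graph_glued])
  define E1 where "E1 = (\<lambda>x. E (Inl x))"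
  define E2 where "E2 = (\<lambda>y. if y = u2 then 0 else E (Inr y))"
  have dE: "decomposes E E1 E2" unfolding decomposes_def E1_def E2_def by simp
  have e1: "is_divisor G1 E1" "effective G1 E1" and e2: "is_divisor G2 E2" "effective G2 E2"
    using E(1,2) unfolding is_divisor_def effective_def E1_def E2_def verts_glued by auto
  have nn: "0 \<le> deg G1 E1" "0 \<le> deg G2 E2"
    using e1 e2 unfolding deg_def effective_def by (auto intro: sum_nonneg)
  let ?P = "\<lambda>l. winnable G1 (\<lambda>x. (D1 x - E1 x) + l * pt v1 x)"
  have mono: "mono ?P"
    by (intro monoI le_boolI) (erule winnable_mono, simp add: pt_def)
  have "\<not> ?P (- deg G1 (\<lambda>x. D1 x - E1 x) - 1)"
    using winnable_imp_deg_nonneg[OF G1] deg_add_mult_pt[OF G1 v1] by fastforce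
  moreover have "?P (genus G1 - deg G1 (\<lambda>x. D1 x - E1 x))"
    by (rule winnable_if_genus_le_deg[OF G1]) (simp add: deg_add_mult_pt[OF G1 v1])
  \<comment> \<open>The least transfer that wins the first side. The second side must fail at
    \<open>t\<close>, and the first fails at \<open>t - 1\<close>.\<close>
  ultimately obtain t where t: "\<forall>l. ?P l \<longleftrightarrow> t \<le> l" using int_threshold[OF mono] by blast
  have "\<not> ?P (t - 1)" "?P t" using t by simp_all
  then have n2: "\<not> winnable G2 (\<lambda>y. (D2 y - E2 y) - t * pt u2 y)"
    using nw winnable_glued_iff[OF decomposes_diff[OF D dE]] by blast
  have "rank G1 (\<lambda>x. D1 x + (t - 1) * pt v1 x) < int (nat (deg G1 E1))"
    by (rule rank_lessI[OF G1 e1]) (use nn \<open>\<not> ?P (t - 1)\<close> in \<open>simp_all add: algebra_simps\<close>)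
  moreover have "rank G2 (\<lambda>y. D2 y - t * pt u2 y) < int (nat (deg G2 E2))"
    by (rule rank_lessI[OF G2 e2]) (use nn n2 in \<open>simp_all add: algebra_simps\<close>)
  ultimately have "?r1 t + ?r2 t \<le> int r" using nn deg_decomposes[OF dE] E(3) by simp
  then show "\<exists>m. ?r1 m + ?r2 m \<le> int r" by blast
next
  assume "\<exists>m. ?r1 m + ?r2 m \<le> int r"
  then obtain m where m: "?r1 m + ?r2 m \<le> int r" by blast
  define a where "a = nat (?r1 m)"
  \<comment> \<open>The first obstruction takes as few chips as possible; \<open>b\<close> is what
    remains of \<open>r\<close>, and it is large enough for the second.\<close>
  define b where "b = r - a"
  have a: "int a = ?r1 m" unfolding a_def using rank_ge_minus_one[of G1 "\<lambda>x. D1 x + (m - 1) * pt v1 x"] by simp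
  have r2: "0 \<le> ?r2 m" using rank_ge_minus_one[of G2 "\<lambda>y. D2 y - m * pt u2 y"] by linarith
  then have ab: "int a + int b = int r" and b: "?r2 m \<le> int b" using m a unfolding b_def by linarith+
  have "rank G1 (\<lambda>x. D1 x + (m - 1) * pt v1 x) < int a" using a by simp
  then obtain E1 where E1: "is_divisor G1 E1" "effective G1 E1" "deg G1 E1 = int a"
    and n1: "\<not> winnable G1 (\<lambda>x. D1 x + (m - 1) * pt v1 x - E1 x)" by (rule rank_lessE[OF G1])
  have "rank G2 (\<lambda>y. D2 y - m * pt u2 y) < int b" using b by simp
  then obtain E2 where E2: "is_divisor G2 E2" "effective G2 E2" "deg G2 E2 = int b"
    and n2: "\<not> winnable G2 (\<lambda>y. D2 y - m * pt u2 y - E2 y)" by (rule rank_lessE[OF G2])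
  \<comment> \<open>\<open>Inr u2\<close> is not a vertex, so \<open>E\<close> is 0 there and the
    chips of \<open>E2\<close> at \<open>u2\<close> are placed on \<open>Inl v1\<close>.\<close>
  define E where "E = case_sum (\<lambda>x. E1 x + (if x = v1 then E2 u2 else 0)) (\<lambda>y. if y = u2 then 0 else E2 y)"
  have dE: "decomposes E E1 E2" unfolding decomposes_def E_def by simp
  have "is_divisor glued E"
    unfolding is_divisor_def
  proof (intro allI impI)
    fix p assume "p \<notin> verts glued"
    then show "E p = 0" using E1(1) E2(1) v1 unfolding verts_glued is_divisor_def E_def
      by (cases p) auto
  qed
  moreover have "effective glued E"
    using E1(2) E2(2) u2 unfolding effective_def verts_glued E_def by (auto split: if_splits)
  moreover have "deg glued E = int r" using deg_decomposes[OF dE] E1(3) E2(3) ab by simp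
  moreover have "\<not> winnable glued (\<lambda>x. D x - E x)"
  proof
    assume "winnable glued (\<lambda>x. D x - E x)"
    then obtain l where l: "winnable G1 (\<lambda>x. D1 x - E1 x + l * pt v1 x)"
        "winnable G2 (\<lambda>y. D2 y - E2 y - l * pt u2 y)"
      using winnable_glued_iff[OF decomposes_diff[OF D dE]] by blast
    show False
    proof (cases "l \<le> m - 1")
      case True
      have "winnable G1 (\<lambda>x. D1 x + (m - 1) * pt v1 x - E1 x)"
        using l(1) by (rule winnable_mono) (use True in \<open>simp add: pt_def\<close>)
      then show False using n1 by blast
    next
      case False
      have "winnable G2 (\<lambda>y. D2 y - m * pt u2 y - E2 y)"
        using l(2) by (rule winnable_mono) (use False in \<open>simp add: pt_def\<close>)
      then show False using n2 by blast
    qed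
  qed
  ultimately show "rank glued D < int r" by (rule rank_lessI[OF is_graph_glued])
qed

lemma rank_glued_is_minimum:
  assumes D: "decomposes D D1 D2"
  shows "is_minimum (\<lambda>m. (rank G1 (\<lambda>x. D1 x + (m - 1) * pt v1 x) + 1)
      + (rank G2 (\<lambda>y. D2 y - m * pt u2 y) + 1)) (rank glued D + 1)" (is "is_minimum ?F _")
proof -
  have nn: "0 \<le> ?F m" for m
    using rank_ge_minus_one[of G1 "\<lambda>x. D1 x + (m - 1) * pt v1 x"]
      rank_ge_minus_one[of G2 "\<lambda>y. D2 y - m * pt u2 y"] by linarith
  have le: "rank glued D + 1 \<le> ?F m" for m
    using rank_glued_less_iff[OF D, of "nat (?F m)"] nn[of m] by auto
  have "rank glued D < int (nat (rank glued D + 1))" using rank_ge_minus_one[of glued D] by simp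
  then obtain m where "?F m \<le> int (nat (rank glued D + 1))"
    unfolding rank_glued_less_iff[OF D] by blast
  then have "?F m = rank glued D + 1" using le[of m] rank_ge_minus_one[of glued D] by simp
  then show ?thesis using le unfolding is_minimum_def by blast
qed

end

section \<open>Brill-Noether generality of the glued graph\<close>

theorem mainTheorem9:
  fixes G1 :: "'a mgraph" and u1 v1 :: 'a
    and G2 :: "'b mgraph" and u2 v2 :: 'b
    and k :: nat
  assumes "is_graph G1" and "u1 \<in> verts G1" and "v1 \<in> verts G1"
    and "is_graph G2" and "u2 \<in> verts G2" and "v2 \<in> verts G2"
    and "all_submodular G1 u1 v1"
    and "all_submodular G2 u2 v2"
    and "BN_general G1 v1"
    and "k_general_transmission k G2 u2 v2"
    and "int k > genus G1 + genus G2"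
  shows "BN_general (vertex_glue G1 v1 G2 u2) (glue_map v1 u2 v2)"
proof -
  interpret vertex_gluing G1 v1 G2 u2 using assms by unfold_locales
  have k: "0 < k" using assms(11) genus_nonneg[OF G1] genus_nonneg[OF G2] by simp
  have lin: "lin_equiv G2 (\<lambda>x. int k * pt u2 x) (\<lambda>x. int k * pt v2 x)"
    and inv: "\<And>D. is_divisor G2 D \<Longrightarrow> inv_k (int k) (transmission G2 u2 v2 D) \<le> enat (nat (genus G2))"
    using assms(10) unfolding k_general_transmission_def by auto
  have gv: "glue v2 \<in> verts glued" using glue_in_verts assms(6) .
  show ?thesis unfolding BN_general_iff[OF is_graph_glued gv]
  proof (intro allI impI)
    fix D assume D: "is_divisor glued D"
    define D1 where "D1 = (\<lambda>x. D (Inl x))"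
    \<comment> \<open>All chips at the gluing vertex are already counted in
      \<open>D1\<close>.\<close>
    define D2 where "D2 = (\<lambda>y. if y = u2 then 0 else D (Inr y))"
    have d1: "is_divisor G1 D1" and d2: "is_divisor G2 D2"
      using D unfolding is_divisor_def D1_def D2_def verts_glued by auto
    define \<rho> where "\<rho> = (\<lambda>m. rank G1 (\<lambda>x. D1 x + m * pt v1 x) + 1)"
    define Q where "Q = (\<lambda>l. rank glued (\<lambda>x. D x + l * pt (glue v2) x) + 1)"
    define \<tau> where "\<tau> = transmission G2 u2 v2 D2"
    have st: "staircase (genus G1 - deg G1 D1) \<rho>"
      unfolding \<rho>_def by (rule staircase_rank[OF G1 v1])
    have ex: "excess (genus G1 - deg G1 D1) \<rho> \<le> genus G1"
      using assms(9) d1 unfolding BN_general_iff[OF G1 v1] \<rho>_def by blast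
    obtain n where n: "inv_k (int k) \<tau> = enat n" "int n \<le> genus G2"
    proof -
      have le: "inv_k (int k) \<tau> \<le> enat (nat (genus G2))" unfolding \<tau>_def by (rule inv[OF d2])
      then obtain n where "inv_k (int k) \<tau> = enat n" by (cases "inv_k (int k) \<tau>") auto
      moreover have "int n \<le> genus G2" using le calculation genus_nonneg[OF G2] by simp
      ultimately show ?thesis by (rule that)
    qed
    have "submodular G2 u2 v2 D2" using assms(8) d2 unfolding all_submodular_def by blast
    note \<tau> = transmission_props[OF G2 u2 assms(6) this lin k, folded \<tau>_def]
    have min: "is_minimum (\<lambda>m. \<rho> (m - 1) + dominance \<tau> (- m) (- l)) (Q l)" for l
    proof -
      \<comment> \<open>This includes the case \<open>v2 = u2\<close>, where the twist lands on the
        gluing vertex and is booked on the second side.\<close>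
      have "decomposes (\<lambda>x. D x + l * pt (glue v2) x) D1 (\<lambda>y. D2 y + l * pt v2 y)"
        unfolding decomposes_def D1_def D2_def pt_def glue_map_def by auto
      from rank_glued_is_minimum[OF this]
      have "is_minimum (\<lambda>m. \<rho> (m - 1) + (rank G2 (\<lambda>y. D2 y + l * pt v2 y - m * pt u2 y) + 1)) (Q l)"
        unfolding \<rho>_def Q_def .
      moreover have "rank G2 (\<lambda>y. D2 y + l * pt v2 y - m * pt u2 y) + 1 = dominance \<tau> (- m) (- l)" for m
      proof -
        have "(\<lambda>y. D2 y + l * pt v2 y - m * pt u2 y) = twist u2 v2 D2 (- m) (- (- l))"
          unfolding twist_def by auto
        then show ?thesis using \<tau>(3)[of "- m" "- l"] by simp
      qed
      ultimately show ?thesis by simp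
    qed
    have "excess (genus G1 - deg G1 D1) \<rho> + int n < int k" using ex n(2) assms(11) by simp
    then obtain c where c: "staircase c Q" "excess c Q \<le> excess (genus G1 - deg G1 D1) \<rho> + int n"
      using excess_dominance_product[OF st _ \<tau>(1,2) n(1) _ min] k by auto
    \<comment> \<open>The product theorem leaves the offset \<open>c\<close> unspecified; the
      asymptotics of the rank on the glued graph determine it.\<close>
    have "staircase (genus glued - deg glued D) Q"
      unfolding Q_def by (rule staircase_rank[OF is_graph_glued gv])
    then have "c = genus glued - deg glued D" using c(1) staircase_unique by blast
    then show "excess (genus glued - deg glued D) (\<lambda>m. rank glued (\<lambda>x. D x + m * pt (glue v2) x) + 1)
        \<le> genus glued"
      using c(2) ex n(2) unfolding Q_def genus_glued by simp
  qed
qed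

end
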